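(* Let $\{S(t):t\geq 0\}$ be a real-valued Lévy process such that $\log\mathbb{E}[e^{\theta S(1)}]$ is finite in a neighborhood of $\theta=0$; assume that $\{S(t):t\geq 0\}$ has bounded variation and is not a subordinator. Let $\{S_1(t):t\geq 0\}$ and $\{S_2(t):t\geq 0\}$ be two non-null independent subordinators such that $\{S(t):t\geq 0\}$ is distributed as $\{S_1(t)-S_2(t):t\geq 0\}$, and let $\kappa_{S_i}(\theta):=\log\mathbb{E}[e^{\theta S_i(1)}]$ for $i=1,2$. For $i=1,2$ let $f_i:[0,\infty)\to\mathbb{R}$ be a differentiable, convex and non-decreasing function with $f_i(0)=0$ and $f_i'(0)=0$ (right derivative at $0$), and let $\{L_{f_1}^{(1)}(t):t\geq 0\}$ and $\{L_{f_2}^{(2)}(t):t\geq 0\}$ be two independent nonnegative processes, independent of $\{(S_1(t),S_2(t)):t\geq 0\}$, such that for $i=1,2$ and every $\rho\in\mathbb{R}$ the following limit exists and satisfies $$\lim_{t\to\infty}\frac{1}{t}\log\mathbb{E}[e^{\rho L_{f_i}^{(i)}(t)}]=\begin{cases} f_i(\rho) & \text{if } \rho\geq 0,\\ 0 & \text{if } \rho<0.\end{cases}$$ Let $\Psi_{f_1,f_2}$ be the function defined by $$\Psi_{f_1,f_2}(\theta):=\begin{cases} f_1(\kappa_{S_1}(\theta)) & \text{if } \theta\geq 0,\\ f_2(\kappa_{S_2}(-\theta)) & \text{if } \theta<0,\end{cases}$$ and assume that it is essentially smooth. Then $\left\{\frac{S_1(L_{f_1}^{(1)}(t))-S_2(L_{f_2}^{(2)}(t))}{t}:t>0\right\}$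 satisfies the large deviation principle (as $t\to\infty$) with speed $v_t=t$ and good rate function $J_{\mathrm{LD},f_1,f_2}$ defined by $$J_{\mathrm{LD},f_1,f_2}(x):=\sup_{\theta\in\mathbb{R}}\{\theta x-\Psi_{f_1,f_2}(\theta)\}.$$
   Context: A subordinator is a nondecreasing real-valued Lévy process; non-null means not identically zero. Under the stated assumptions on $S$ the functions $\kappa_{S_1},\kappa_{S_2}$ are finite in a neighborhood of the origin. They take values in $(-\infty,\infty]$, and $f_i(\infty)=\infty$ by convention. Large deviation principle (LDP): a family of real random variables $\{Z(t):t>0\}$ satisfies the LDP with speed $v_t\to\infty$ and rate function $I:\mathbb{R}\to[0,\infty]$ (lower semicontinuous) if $\limsup_{t\to\infty}\frac{1}{v_t}\log P(Z(t)\in C)\leq-\inf_{x\in C}I(x)$ for all closed sets $C$ and $\liminf_{t\to\infty}\frac{1}{v_t}\log P(Z(t)\in O)\geq-\inf_{x\in O}I(x)$ for all open sets $O$. The rate function $I$ is good if all level sets $\{x\in\mathbb{R}:I(x)\leq b\}$, $b\geq 0$, are compact. Essentially smooth: a function $\Lambda:\mathbb{R}\to(-\infty,\infty]$ with $\mathcal{D}(\Lambda):=\{\theta\in\mathbb{R}:\Lambda(\theta)<\infty\}$ is essentially smooth if the interior of $\mathcal{D}(\Lambda)$ is non-empty, $\Lambda$ is differentiable throughout this interior, and $\Lambda$ is steep, i.e. $|\Lambda'(\theta_n)|\to\infty$ whenever $(\theta_n)$ is a sequence in the interior of $\mathcal{D}(\Lambda)$ converging to a boundary point of $\mathcal{D}(\Lambda)$.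 *)

theory Defs
  imports "HOL-Probability.Probability"
begin

text \<open>The library has \<^term>\<open>ln (0::real) = 0\<close>, so that the real logarithm cannot be used for
  probabilities that may vanish or for exponential moments that may be infinite.\<close>

definition ext_ln :: "ennreal \<Rightarrow> ereal" where
  "ext_ln x = (if x = 0 then -\<infinity> else if x = \<top> then \<infinity> else ereal (ln (enn2real x)))"

definition log_mgf :: "'a measure \<Rightarrow> ('a \<Rightarrow> real) \<Rightarrow> real \<Rightarrow> ereal" where
  "log_mgf M X \<theta> = ext_ln (\<integral>\<^sup>+ \<omega>. ennreal (exp (\<theta> * X \<omega>)) \<partial>M)"

text \<open>A process is a function \<^term>\<open>X :: real \<Rightarrow> 'a \<Rightarrow> real\<close> of which only the values at times
  \<^term>\<open>t \<ge> (0::real)\<close> matter. As a random element it takes values in the product space below.\<close>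

abbreviation path_space :: "(real \<Rightarrow> real) measure" where
  "path_space \<equiv> PiM {0..} (\<lambda>_. borel)"

definition path :: "(real \<Rightarrow> 'a \<Rightarrow> real) \<Rightarrow> 'a \<Rightarrow> real \<Rightarrow> real" where
  "path X \<omega> = (\<lambda>t\<in>{0..}. X t \<omega>)"

definition cadlag :: "(real \<Rightarrow> real) \<Rightarrow> bool" where
  "cadlag g \<longleftrightarrow>
    (\<forall>t\<ge>0. (g \<longlongrightarrow> g t) (at_right t)) \<and> (\<forall>t>0. \<exists>l. (g \<longlongrightarrow> l) (at_left t))"

definition bounded_variation_on :: "real set \<Rightarrow> (real \<Rightarrow> real) \<Rightarrow> bool" where
  "bounded_variation_on A g \<longleftrightarrow>
    (\<exists>B. \<forall>n (t :: nat \<Rightarrow> real). (\<forall>i\<le>n. t i \<in> A) \<longrightarrow> (\<forall>i<n. t i \<le> t (Suc i)) \<longrightarrow>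
      (\<Sum>i<n. \<bar>g (t (Suc i)) - g (t i)\<bar>) \<le> B)"

context prob_space
begin

text \<open>Stochastic continuity is not listed separately, because it follows from right-continuity
  of the paths and stationarity of the increments.\<close>

definition levy_process :: "(real \<Rightarrow> 'a \<Rightarrow> real) \<Rightarrow> bool" where
  "levy_process X \<longleftrightarrow>
    (\<forall>t\<ge>0. random_variable borel (X t)) \<and>
    (AE \<omega> in M. X 0 \<omega> = 0) \<and>
    (\<forall>n (t :: nat \<Rightarrow> real). 0 \<le> t 0 \<longrightarrow> (\<forall>i<n. t i < t (Suc i)) \<longrightarrow>
      indep_vars (\<lambda>_. borel) (\<lambda>i \<omega>. X (t (Suc i)) \<omega> - X (t i) \<omega>) {..<n}) \<and>
    (\<forall>s\<ge>0. \<forall>t\<ge>0. distr M borel (\<lambda>\<omega>. X (s + t) \<omega> - X s \<omega>) = distr M borel (X t)) \<and>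
    (AE \<omega> in M. cadlag (\<lambda>t. X t \<omega>))"

definition subordinator :: "(real \<Rightarrow> 'a \<Rightarrow> real) \<Rightarrow> bool" where
  "subordinator X \<longleftrightarrow> levy_process X \<and> (AE \<omega> in M. mono_on {0..} (\<lambda>t. X t \<omega>))"

definition null_process :: "(real \<Rightarrow> 'a \<Rightarrow> real) \<Rightarrow> bool" where
  "null_process X \<longleftrightarrow> (AE \<omega> in M. \<forall>t\<ge>0. X t \<omega> = 0)"

definition bounded_variation_process :: "(real \<Rightarrow> 'a \<Rightarrow> real) \<Rightarrow> bool" where
  "bounded_variation_process X \<longleftrightarrow>
    (AE \<omega> in M. \<forall>T\<ge>0. bounded_variation_on {0..T} (\<lambda>t. X t \<omega>))"

definition nonneg_process :: "(real \<Rightarrow> 'a \<Rightarrow> real) \<Rightarrow> bool" where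
  "nonneg_process X \<longleftrightarrow>
    (\<forall>t\<ge>0. random_variable borel (X t) \<and> (AE \<omega> in M. 0 \<le> X t \<omega>))"

definition indep_processes ::
  "(real \<Rightarrow> 'a \<Rightarrow> real) \<Rightarrow> (real \<Rightarrow> 'a \<Rightarrow> real) \<Rightarrow> bool" where
  "indep_processes X Y \<longleftrightarrow> indep_var path_space (path X) path_space (path Y)"

definition indep_process_pairs ::
  "(real \<Rightarrow> 'a \<Rightarrow> real) \<Rightarrow> (real \<Rightarrow> 'a \<Rightarrow> real) \<Rightarrow>
   (real \<Rightarrow> 'a \<Rightarrow> real) \<Rightarrow> (real \<Rightarrow> 'a \<Rightarrow> real) \<Rightarrow> bool" where
  "indep_process_pairs X X' Y Y' \<longleftrightarrow>
    indep_var (path_space \<Otimes>\<^sub>M path_space) (\<lambda>\<omega>. (path X \<omega>, path X' \<omega>))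
              (path_space \<Otimes>\<^sub>M path_space) (\<lambda>\<omega>. (path Y \<omega>, path Y' \<omega>))"

end

definition same_law ::
  "'a measure \<Rightarrow> (real \<Rightarrow> 'a \<Rightarrow> real) \<Rightarrow> 'b measure \<Rightarrow> (real \<Rightarrow> 'b \<Rightarrow> real) \<Rightarrow> bool" where
  "same_law M X N Y \<longleftrightarrow> distr M path_space (path X) = distr N path_space (path Y)"

definition lower_semicontinuous :: "(real \<Rightarrow> ereal) \<Rightarrow> bool" where
  "lower_semicontinuous I \<longleftrightarrow> (\<forall>x. I x \<le> Liminf (at x) I)"

definition rate_function :: "(real \<Rightarrow> ereal) \<Rightarrow> bool" where
  "rate_function I \<longleftrightarrow> (\<forall>x. 0 \<le> I x) \<and> lower_semicontinuous I"

definition good_rate_function :: "(real \<Rightarrow> ereal) \<Rightarrow> bool" where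
  "good_rate_function I \<longleftrightarrow>
    rate_function I \<and> (\<forall>b::real. 0 \<le> b \<longrightarrow> compact {x. I x \<le> ereal b})"

definition satisfies_LDP ::
  "'a measure \<Rightarrow> (real \<Rightarrow> 'a \<Rightarrow> real) \<Rightarrow> (real \<Rightarrow> real) \<Rightarrow> (real \<Rightarrow> ereal) \<Rightarrow> bool" where
  "satisfies_LDP M Z v I \<longleftrightarrow>
    (\<forall>t>0. Z t \<in> borel_measurable M) \<and>
    filterlim v at_top at_top \<and>
    rate_function I \<and>
    (\<forall>C. closed C \<longrightarrow>
      Limsup at_top (\<lambda>t. ext_ln (emeasure M {\<omega> \<in> space M. Z t \<omega> \<in> C}) / ereal (v t))
        \<le> - (INF x\<in>C. I x)) \<and>
    (\<forall>G. open G \<longrightarrow>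
      - (INF x\<in>G. I x)
        \<le> Liminf at_top (\<lambda>t. ext_ln (emeasure M {\<omega> \<in> space M. Z t \<omega> \<in> G}) / ereal (v t)))"

definition effective_domain :: "(real \<Rightarrow> ereal) \<Rightarrow> real set" where
  "effective_domain \<Lambda> = {\<theta>. \<Lambda> \<theta> < \<infinity>}"

text \<open>The function is required to take values in \<open>(-\<infinity>, \<infinity>]\<close>, so on its effective
  domain it agrees with its real part.\<close>

definition essentially_smooth :: "(real \<Rightarrow> ereal) \<Rightarrow> bool" where
  "essentially_smooth \<Lambda> \<longleftrightarrow>
    (\<forall>\<theta>. \<Lambda> \<theta> \<noteq> -\<infinity>) \<and>
    interior (effective_domain \<Lambda>) \<noteq> {} \<and>
    (\<forall>\<theta>\<in>interior (effective_domain \<Lambda>). (\<lambda>\<theta>. real_of_ereal (\<Lambda> \<theta>)) differentiable (at \<theta>)) \<and>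
    (\<forall>(\<theta> :: nat \<Rightarrow> real) \<theta>\<^sub>0.
      (\<forall>n. \<theta> n \<in> interior (effective_domain \<Lambda>)) \<longrightarrow>
      \<theta>\<^sub>0 \<in> frontier (effective_domain \<Lambda>) \<longrightarrow> \<theta> \<longlonglongrightarrow> \<theta>\<^sub>0 \<longrightarrow>
      filterlim (\<lambda>n. \<bar>deriv (\<lambda>\<theta>. real_of_ereal (\<Lambda> \<theta>)) (\<theta> n)\<bar>) at_top sequentially)"

text \<open>A function \<open>f\<close> on \<open>[0,\<infinity>)\<close> is extended by \<open>f(\<infinity>) = \<infinity>\<close>.\<close>

definition ext_inf :: "(real \<Rightarrow> real) \<Rightarrow> ereal \<Rightarrow> ereal" where
  "ext_inf f k = (if k = \<infinity> then \<infinity> else ereal (f (real_of_ereal k)))"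

definition Psi ::
  "(real \<Rightarrow> real) \<Rightarrow> (real \<Rightarrow> real) \<Rightarrow> (real \<Rightarrow> ereal) \<Rightarrow> (real \<Rightarrow> ereal) \<Rightarrow> real \<Rightarrow> ereal" where
  "Psi f1 f2 \<kappa>1 \<kappa>2 \<theta> =
    (if 0 \<le> \<theta> then ext_inf f1 (\<kappa>1 \<theta>) else ext_inf f2 (\<kappa>2 (- \<theta>)))"

definition legendre_transform :: "(real \<Rightarrow> ereal) \<Rightarrow> real \<Rightarrow> ereal" where
  "legendre_transform \<Lambda> x = (SUP \<theta>. ereal (\<theta> * x) - \<Lambda> \<theta>)"

text \<open>The properties required of \<open>f\<close> on \<open>[0,\<infinity>)\<close>; its values at negative arguments are
  irrelevant, and the derivative at \<open>0\<close> is the right one.\<close>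

definition admissible :: "(real \<Rightarrow> real) \<Rightarrow> bool" where
  "admissible f \<longleftrightarrow>
    f differentiable_on {0..} \<and> convex_on {0..} f \<and> mono_on {0..} f \<and>
    f 0 = 0 \<and> (f has_real_derivative 0) (at 0 within {0..})"

definition log_mgf_limit ::
  "'a measure \<Rightarrow> (real \<Rightarrow> 'a \<Rightarrow> real) \<Rightarrow> (real \<Rightarrow> real) \<Rightarrow> bool" where
  "log_mgf_limit M L f \<longleftrightarrow>
    (\<forall>\<rho>. ((\<lambda>t. log_mgf M (L t) \<rho> / ereal t) \<longlongrightarrow> ereal (if 0 \<le> \<rho> then f \<rho> else 0)) at_top)"

text \<open>The paths of the subordinators are only almost surely well behaved, so without completeness
  of the probability space the time-changed variables need only be measurable up to a null set.
  Statements about them should therefore refer to \<^const>\<open>completion\<close>, which changes neither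
  complete spaces nor the probability of any event.\<close>

definition scaled_difference ::
  "(real \<Rightarrow> 'a \<Rightarrow> real) \<Rightarrow> (real \<Rightarrow> 'a \<Rightarrow> real) \<Rightarrow>
   (real \<Rightarrow> 'a \<Rightarrow> real) \<Rightarrow> (real \<Rightarrow> 'a \<Rightarrow> real) \<Rightarrow> real \<Rightarrow> 'a \<Rightarrow> real" where
  "scaled_difference S1 L1 S2 L2 t \<omega> = (S1 (L1 t \<omega>) \<omega> - S2 (L2 t \<omega>) \<omega>) / t"

end

theory Submission
  imports Defs
begin

text \<open>The theorem is a Gartner-Ellis argument. Write \<open>X t = S1 (L1 t) - S2 (L2 t)\<close> and
  \<open>\<Psi>\<close> for the function \<open>Psi f1 f2 \<kappa>1 \<kappa>2\<close>.

  Conditionally on the clocks, a Levy process at time \<open>l\<close> has moment generating function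
  \<open>exp (l * \<kappa> \<theta>)\<close>, so that by independence
  \<open>E exp (\<theta> * X t) = E exp (\<kappa>1 \<theta> * L1 t) * E exp (\<kappa>2 (- \<theta>) * L2 t)\<close>. For \<open>\<theta> \<ge> 0\<close> the first
  exponent is nonnegative and the second one nonpositive, so that the first factor grows at rate
  \<open>f1 (\<kappa>1 \<theta>)\<close> and the second one at rate \<open>0\<close>; for \<open>\<theta> < 0\<close> the roles are exchanged. Hence the
  scaled cumulant generating functions of \<open>X t / t\<close> converge to \<open>\<Psi>\<close> wherever \<open>\<Psi>\<close> is finite.
  Because subordinators are monotone, it suffices to evaluate them at the integers surrounding the
  clock: the identity then holds up to factors that do not depend on \<open>t\<close>, which vanish on the
  exponential scale, and only the moments at integer times enter
  (\<open>mgf_integer_clocks\<close>, \<open>mgf_difference_le\<close>, \<open>mgf_difference_ge\<close>).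

  The limit \<open>\<Psi>\<close> vanishes at \<open>0\<close> and is monotone on either side of \<open>0\<close>. This shape, captured by
  the locale \<open>unimodal_cgf\<close>, makes the Gartner-Ellis theorem elementary. The rate function vanishes
  at \<open>0\<close> and does not decrease away from it, so a closed set that misses \<open>0\<close> may be replaced by two
  rays, which start at its points closest to \<open>0\<close> on either side and for which Chernoff's inequality
  is enough (\<open>upper_bound\<close>). Around a slope \<open>y\<close> of \<open>\<Psi>\<close> the
  lower bound follows by exponential tilting (\<open>lower_bound_ball\<close>). Steepness guarantees that the
  slopes come arbitrarily close to every point where the rate function is finite, from the side
  on which the rate function is no larger (\<open>slopes_dense\<close>); this gives the lower bound for all
  open sets.\<close>

section \<open>Exponential growth rates\<close>

text \<open>Bounds on \<open>ext_ln p / t\<close> are the same as exponential bounds on \<open>p\<close> itself. This turns every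
  asymptotic statement below into inequalities between nonnegative numbers, where sums and
  infinite values cause no trouble.\<close>

lemma ext_ln_div_le_iff:
  assumes "0 < t"
  shows "ext_ln p / ereal t \<le> ereal r \<longleftrightarrow> p \<le> ennreal (exp (r * t))"
proof (cases p)
  case (real q)
  show ?thesis
  proof (cases "q = 0")
    case True
    then show ?thesis using real assms by (simp add: ext_ln_def)
  next
    case False
    then have "0 < q" using real by simp
    then have "ln q / t \<le> r \<longleftrightarrow> q \<le> exp (r * t)"
      using assms by (simp add: pos_divide_le_eq ln_le_cancel_iff[symmetric] del: ln_le_cancel_iff)
    then show ?thesis using real assms \<open>0 < q\<close> by (simp add: ext_ln_def ennreal_eq_0_iff)
  qed
next
  case top
  then show ?thesis using assms by (simp add: ext_ln_def top_unique)
qed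

lemma le_ext_ln_div_iff:
  assumes "0 < t"
  shows "ereal r \<le> ext_ln p / ereal t \<longleftrightarrow> ennreal (exp (r * t)) \<le> p"
proof (cases p)
  case (real q)
  show ?thesis
  proof (cases "q = 0")
    case True
    then show ?thesis using real assms by (simp add: ext_ln_def)
  next
    case False
    then have "0 < q" using real by simp
    then have "r \<le> ln q / t \<longleftrightarrow> exp (r * t) \<le> q"
      using assms by (simp add: pos_le_divide_eq ln_ge_iff)
    then show ?thesis using real assms \<open>0 < q\<close> by (simp add: ext_ln_def ennreal_eq_0_iff)
  qed
next
  case top
  then show ?thesis using assms by (simp add: ext_ln_def)
qed

lemma tendsto_ext_ln_div_iff:
  "((\<lambda>t. ext_ln (p t) / ereal t) \<longlongrightarrow> ereal l) at_top \<longleftrightarrow>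
    (\<forall>e>0. \<forall>\<^sub>F t in at_top. ennreal (exp ((l - e) * t)) \<le> p t \<and> p t \<le> ennreal (exp ((l + e) * t)))"
    (is "?lim \<longleftrightarrow> (\<forall>e>0. ?ev e)")
proof
  assume lim: ?lim
  show "\<forall>e>0. ?ev e"
  proof (intro allI impI)
    fix e :: real assume "0 < e"
    then have "\<forall>\<^sub>F t in at_top. ereal (l - e) < ext_ln (p t) / ereal t"
      and "\<forall>\<^sub>F t in at_top. ext_ln (p t) / ereal t < ereal (l + e)"
      using lim by (auto intro: order_tendstoD)
    then show "?ev e"
      using eventually_gt_at_top[of 0]
      by eventually_elim (auto simp: le_ext_ln_div_iff[symmetric] ext_ln_div_le_iff[symmetric])
  qed
next
  assume ev: "\<forall>e>0. ?ev e"
  show ?lim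
  proof (rule order_tendstoI)
    fix a assume "a < ereal l"
    then obtain r where r: "a < ereal r" "ereal r < ereal l" using ereal_dense2 by blast
    then have "?ev (l - r)" by (intro ev[rule_format]) simp
    then show "\<forall>\<^sub>F t in at_top. a < ext_ln (p t) / ereal t"
      using eventually_gt_at_top[of 0]
      by eventually_elim (use r in \<open>auto simp: le_ext_ln_div_iff[symmetric] intro: less_le_trans\<close>)
  next
    fix a assume "ereal l < a"
    then obtain r where r: "ereal r < a" "ereal l < ereal r" using ereal_dense2 by blast
    then have "?ev (r - l)" by (intro ev[rule_format]) simp
    then show "\<forall>\<^sub>F t in at_top. ext_ln (p t) / ereal t < a"
      using eventually_gt_at_top[of 0]
      by eventually_elim (use r in \<open>auto simp: ext_ln_div_le_iff[symmetric] intro: le_less_trans\<close>)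
  qed
qed

lemma Limsup_ext_ln_div_le:
  assumes "\<And>r. c < ereal r \<Longrightarrow> \<forall>\<^sub>F t in at_top. p t \<le> ennreal (exp (r * t))"
  shows "Limsup at_top (\<lambda>t. ext_ln (p t) / ereal t) \<le> c"
proof (rule ccontr)
  assume "\<not> ?thesis"
  then obtain r where r: "c < ereal r" "ereal r < Limsup at_top (\<lambda>t. ext_ln (p t) / ereal t)"
    using ereal_dense2 by (metis not_le)
  have "\<forall>\<^sub>F t in at_top. ext_ln (p t) / ereal t \<le> ereal r"
    using assms[OF r(1)] eventually_gt_at_top[of 0]
    by eventually_elim (simp add: ext_ln_div_le_iff)
  then have "Limsup at_top (\<lambda>t. ext_ln (p t) / ereal t) \<le> ereal r" by (rule Limsup_bounded)
  with r(2) show False by simp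
qed

lemma Liminf_ext_ln_div_ge:
  assumes "\<And>r. ereal r < c \<Longrightarrow> \<forall>\<^sub>F t in at_top. ennreal (exp (r * t)) \<le> p t"
  shows "c \<le> Liminf at_top (\<lambda>t. ext_ln (p t) / ereal t)"
proof (rule ccontr)
  assume "\<not> ?thesis"
  then obtain r where r: "ereal r < c" "Liminf at_top (\<lambda>t. ext_ln (p t) / ereal t) < ereal r"
    using ereal_dense2 by (metis not_le)
  have "\<forall>\<^sub>F t in at_top. ereal r \<le> ext_ln (p t) / ereal t"
    using assms[OF r(1)] eventually_gt_at_top[of 0]
    by eventually_elim (simp add: le_ext_ln_div_iff)
  then have "ereal r \<le> Liminf at_top (\<lambda>t. ext_ln (p t) / ereal t)" by (rule Liminf_bounded)
  with r(2) show False by simp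
qed

lemma ext_ln_eq_ereal: "ext_ln p = ereal r \<longleftrightarrow> p = ennreal (exp r)"
proof (cases p)
  case (real q)
  show ?thesis
  proof (cases "q = 0")
    case True
    then show ?thesis using real by (simp add: ext_ln_def)
  next
    case False
    then have "0 < q" using real by simp
    then have "ln q = r \<longleftrightarrow> q = exp r" by auto
    then show ?thesis using real \<open>0 < q\<close> by (simp add: ext_ln_def ennreal_eq_0_iff)
  qed
qed (simp add: ext_ln_def)

lemma ext_ln_mono: "p \<le> q \<Longrightarrow> ext_ln p \<le> ext_ln q"
proof (cases "p = 0 \<or> q = \<top>")
  case False
  assume "p \<le> q"
  with False obtain a b where ab: "p = ennreal a" "q = ennreal b" "0 \<le> a" "0 \<le> b"
    by (cases p; cases q) (auto simp: top_unique)
  with False \<open>p \<le> q\<close> have "0 < a" "a \<le> b" by auto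
  then show ?thesis using ab by (simp add: ext_ln_def ennreal_eq_0_iff)
qed (auto simp: ext_ln_def)

lemma ext_ln_finite_iff: "ext_ln p < \<infinity> \<longleftrightarrow> p < \<top>"
  by (auto simp: ext_ln_def less_top)

lemma eventually_const_le_exp:
  fixes C e :: real assumes "0 < e"
  shows "\<forall>\<^sub>F t in at_top. C \<le> exp (e * t)"
proof -
  have "filterlim (\<lambda>t. exp (e * t)) at_top at_top"
    using assms by (intro filterlim_compose[OF exp_at_top]
        filterlim_tendsto_pos_mult_at_top[OF tendsto_const _ filterlim_ident]) auto
  then show ?thesis by (simp add: filterlim_at_top)
qed

section \<open>Legendre transforms and slopes of unimodal functions\<close>

lemma legendre_transform_ge: "ereal (\<theta> * x) - \<Lambda> \<theta> \<le> legendre_transform \<Lambda> x"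
  unfolding legendre_transform_def by (rule SUP_upper) simp

lemma legendre_transform_reflect:
  "legendre_transform (\<lambda>\<theta>. \<Lambda> (- \<theta>)) x = legendre_transform \<Lambda> (- x)"
proof -
  have "range (\<lambda>\<theta>. ereal (\<theta> * x) - \<Lambda> (- \<theta>)) = (\<lambda>\<theta>. ereal (\<theta> * - x) - \<Lambda> \<theta>) ` range (uminus :: real \<Rightarrow> real)"
    unfolding image_image by simp
  then show ?thesis unfolding legendre_transform_def by (simp add: surj_uminus)
qed

lemma essentially_smooth_reflect:
  assumes "essentially_smooth \<Lambda>"
  shows "essentially_smooth (\<lambda>\<theta>. \<Lambda> (- \<theta>))"
proof -
  let ?D = "effective_domain \<Lambda>" and ?D' = "effective_domain (\<lambda>\<theta>. \<Lambda> (- \<theta>))"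
  let ?g = "\<lambda>\<theta>. real_of_ereal (\<Lambda> \<theta>)" and ?g' = "\<lambda>\<theta>. real_of_ereal (\<Lambda> (- \<theta>))"
  have D': "?D' = uminus ` ?D"
    unfolding effective_domain_def by (auto simp: image_iff intro!: exI[of _ "- _"])
  have int: "interior ?D' = uminus ` interior ?D"
    unfolding D' by (rule interior_negations)
  have "closure ?D' = uminus ` closure ?D"
    unfolding D' by (rule closure_injective_linear_image[symmetric])
      (auto intro: linear_uminus simp: linear_uminus[unfolded o_def] inj_on_def bounded_linear.linear[OF bounded_linear_minus[OF bounded_linear_ident]])
  then have fr: "frontier ?D' = uminus ` frontier ?D"
    unfolding frontier_def int by (auto simp: image_iff)
  have deriv: "\<exists>d. DERIV ?g (- \<theta>) :> d \<and> DERIV ?g' \<theta> :> - d" if "- \<theta> \<in> interior ?D" for \<theta>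
  proof -
    from assms that have "?g differentiable (at (- \<theta>))" unfolding essentially_smooth_def by blast
    then obtain d where "DERIV ?g (- \<theta>) :> d" by (auto simp: real_differentiable_def)
    then show ?thesis using DERIV_mirror[where f = ?g and x = \<theta> and y = d] by blast
  qed
  then have abs_deriv: "\<bar>deriv ?g' \<theta>\<bar> = \<bar>deriv ?g (- \<theta>)\<bar>" if "- \<theta> \<in> interior ?D" for \<theta>
    using DERIV_imp_deriv that by (metis abs_minus_cancel)
  show ?thesis unfolding essentially_smooth_def
  proof (intro conjI allI ballI impI)
    show "\<Lambda> (- \<theta>) \<noteq> - \<infinity>" for \<theta> using assms unfolding essentially_smooth_def by blast
    show "interior ?D' \<noteq> {}" using assms unfolding int essentially_smooth_def by blast
    show "?g' differentiable at \<theta>" if "\<theta> \<in> interior ?D'" for \<theta>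
    proof -
      from that have "- \<theta> \<in> interior ?D" unfolding int by auto
      from deriv[OF this] show ?thesis by (auto simp: real_differentiable_def)
    qed
  next
    fix \<theta> :: "nat \<Rightarrow> real" and \<theta>0
    assume th: "\<forall>n. \<theta> n \<in> interior ?D'" and fr': "\<theta>0 \<in> frontier ?D'" and lim: "\<theta> \<longlonglongrightarrow> \<theta>0"
    have inD: "- \<theta> n \<in> interior ?D" for n using th[rule_format, of n] unfolding int by auto
    have "- \<theta>0 \<in> frontier ?D" using fr' unfolding fr by auto
    moreover have "(\<lambda>n. - \<theta> n) \<longlonglongrightarrow> - \<theta>0" using lim by (rule tendsto_minus)
    ultimately have "filterlim (\<lambda>n. \<bar>deriv ?g (- \<theta> n)\<bar>) at_top sequentially"
      using assms inD unfolding essentially_smooth_def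
      by (elim conjE allE[of _ "\<lambda>n. - \<theta> n"] allE[of _ "- \<theta>0"]) simp
    then show "filterlim (\<lambda>n. \<bar>deriv ?g' (\<theta> n)\<bar>) at_top sequentially"
      using abs_deriv[OF inD] by simp
  qed
qed

text \<open>The shape shared by the limits that occur here. Differentiability at the minimum \<open>0\<close> makes
  the slope there vanish, so that the Gartner-Ellis theorem describes deviations from \<open>0\<close>. The
  assumptions are invariant under \<open>\<theta> \<mapsto> - \<theta>\<close>, hence only the right half-line has to be treated.\<close>

locale unimodal_cgf =
  fixes \<Lambda> :: "real \<Rightarrow> ereal"
  assumes zero: "\<Lambda> 0 = 0"
    and mono_right: "0 \<le> a \<Longrightarrow> a \<le> b \<Longrightarrow> \<Lambda> a \<le> \<Lambda> b"
    and mono_left: "0 \<le> a \<Longrightarrow> a \<le> b \<Longrightarrow> \<Lambda> (- a) \<le> \<Lambda> (- b)"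
    and finite_near_zero: "\<exists>\<delta>>0. \<Lambda> \<delta> < \<infinity> \<and> \<Lambda> (- \<delta>) < \<infinity>"
    and ess_smooth: "essentially_smooth \<Lambda>"
begin

lemma nonneg: "0 \<le> \<Lambda> \<theta>"
  using mono_right[of 0 \<theta>] mono_left[of 0 "- \<theta>"] zero by (cases "0 \<le> \<theta>") auto

lemma ereal_real: "\<Lambda> \<theta> < \<infinity> \<Longrightarrow> \<Lambda> \<theta> = ereal (real_of_ereal (\<Lambda> \<theta>))"
  using nonneg[of \<theta>] by (cases "\<Lambda> \<theta>") auto

lemma reflect: "unimodal_cgf (\<lambda>\<theta>. \<Lambda> (- \<theta>))"
proof
  show "\<exists>\<delta>>0. \<Lambda> (- \<delta>) < \<infinity> \<and> \<Lambda> (- (- \<delta>)) < \<infinity>" using finite_near_zero by auto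
qed (use zero mono_left mono_right essentially_smooth_reflect[OF ess_smooth] in auto)

lemma interior_domainI:
  assumes "0 \<le> \<eta>" "\<eta> < b" "\<Lambda> b < \<infinity>"
  shows "\<eta> \<in> interior (effective_domain \<Lambda>)"
proof -
  obtain \<delta> where \<delta>: "0 < \<delta>" "\<Lambda> (- \<delta>) < \<infinity>" using finite_near_zero by auto
  have "\<theta> \<in> effective_domain \<Lambda>" if "\<theta> \<in> {- \<delta> <..< b}" for \<theta>
    using that mono_right[of \<theta> b] mono_left[of "- \<theta>" \<delta>] assms(3) \<delta>(2)
    by (cases "0 \<le> \<theta>") (auto simp: effective_domain_def)
  then show ?thesis
    using assms \<delta> by (intro interiorI[of "{- \<delta> <..< b}"]) auto
qed

lemma has_derivative_interior:
  assumes "\<eta> \<in> interior (effective_domain \<Lambda>)"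
  shows "DERIV (\<lambda>\<theta>. real_of_ereal (\<Lambda> \<theta>)) \<eta> :> deriv (\<lambda>\<theta>. real_of_ereal (\<Lambda> \<theta>)) \<eta>"
  using assms ess_smooth unfolding essentially_smooth_def
  by (auto simp: real_differentiable_def DERIV_imp_deriv)

lemma real_mono:
  assumes "0 \<le> a" "a \<le> b" "\<Lambda> b < \<infinity>"
  shows "real_of_ereal (\<Lambda> a) \<le> real_of_ereal (\<Lambda> b)"
  using mono_right[OF assms(1,2)] nonneg[of a] assms(3) by (intro real_of_ereal_positive_mono) auto

lemma legendre_nonneg: "0 \<le> legendre_transform \<Lambda> x"
  using legendre_transform_ge[of 0 x \<Lambda>] zero by (simp flip: zero_ereal_def)

lemma legendre_mono:
  assumes "0 \<le> x" "x \<le> y"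
  shows "legendre_transform \<Lambda> x \<le> legendre_transform \<Lambda> y"
  unfolding legendre_transform_def[of _ x]
proof (rule SUP_least)
  fix \<theta> :: real
  show "ereal (\<theta> * x) - \<Lambda> \<theta> \<le> legendre_transform \<Lambda> y"
  proof (cases "0 \<le> \<theta>")
    case True
    then have "ereal (\<theta> * x) - \<Lambda> \<theta> \<le> ereal (\<theta> * y) - \<Lambda> \<theta>"
      using assms by (intro ereal_minus_mono) (auto intro: mult_left_mono)
    also have "\<dots> \<le> legendre_transform \<Lambda> y" by (rule legendre_transform_ge)
    finally show ?thesis .
  next
    case False
    then have "ereal (\<theta> * x) - \<Lambda> \<theta> \<le> 0 - 0"
      using assms nonneg by (intro ereal_minus_mono) (auto simp: mult_nonpos_nonneg)
    also have "\<dots> \<le> legendre_transform \<Lambda> y" using legendre_nonneg by simp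
    finally show ?thesis .
  qed
qed

lemma legendre_zero: "legendre_transform \<Lambda> 0 = 0"
proof (rule antisym)
  show "legendre_transform \<Lambda> 0 \<le> 0"
    unfolding legendre_transform_def
    by (rule SUP_least) (use nonneg in \<open>auto simp: ereal_minus_le_iff simp flip: zero_ereal_def\<close>)
qed (rule legendre_nonneg)

text \<open>If \<open>\<Lambda>\<close> is not finite on all of \<open>[0,\<infinity>)\<close>, the supremum \<open>c\<close> of the part of the domain lying
  there is a positive boundary point that can be approached from inside the domain, and steepness
  applies at \<open>c\<close>.\<close>

lemma steep_right:
  assumes "\<Lambda> b = \<infinity>" "0 \<le> b"
  shows "\<exists>\<eta>\<ge>0. \<eta> \<in> interior (effective_domain \<Lambda>) \<and> y < \<bar>deriv (\<lambda>\<theta>. real_of_ereal (\<Lambda> \<theta>)) \<eta>\<bar>"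
proof -
  define B where "B = {\<theta>. 0 \<le> \<theta> \<and> \<Lambda> \<theta> < \<infinity>}"
  obtain \<delta> where \<delta>: "0 < \<delta>" "\<Lambda> \<delta> < \<infinity>" using finite_near_zero by auto
  have up: "\<theta> \<le> b" if "\<theta> \<in> B" for \<theta>
    using that mono_right[of b \<theta>] assms by (force simp: B_def)
  have bdd: "bdd_above B" using up by (rule bdd_aboveI)
  have \<delta>B: "\<delta> \<in> B" using \<delta> by (simp add: B_def)
  define c where "c = Sup B"
  have c: "\<delta> \<le> c" unfolding c_def using \<delta>B bdd by (rule cSup_upper)
  have below: "\<theta> \<in> interior (effective_domain \<Lambda>)" if \<theta>: "0 \<le> \<theta>" "\<theta> < c" for \<theta>
  proof -
    obtain \<theta>' where "\<theta>' \<in> B" "\<theta> < \<theta>'"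
      using less_cSupD[of B \<theta>] \<theta> \<delta>B unfolding c_def by auto
    then show ?thesis using that by (intro interior_domainI[of \<theta> \<theta>']) (auto simp: B_def)
  qed
  have above: "\<theta> \<notin> effective_domain \<Lambda>" if "c < \<theta>" for \<theta>
  proof
    assume "\<theta> \<in> effective_domain \<Lambda>"
    then have "\<theta> \<in> B" using that c \<delta> by (simp add: B_def effective_domain_def)
    from cSup_upper[OF this bdd] that show False by (simp add: c_def)
  qed
  \<comment> \<open>this sequence starts at \<open>0\<close>, stays in \<open>[0, c)\<close> and converges to \<open>c\<close>\<close>
  define \<theta> where "\<theta> n = c - c / real (Suc n)" for n
  have \<theta>: "0 \<le> \<theta> n" "\<theta> n < c" for n using c \<delta> by (auto simp: \<theta>_def field_simps)
  have "(\<lambda>n. c - c * inverse (real (Suc n))) \<longlonglongrightarrow> c - c * 0"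
    by (intro tendsto_intros LIMSEQ_inverse_real_of_nat)
  then have lim: "\<theta> \<longlonglongrightarrow> c" by (simp add: \<theta>_def[abs_def] divide_inverse)
  have "c \<in> closure (effective_domain \<Lambda>)"
    using lim below[OF \<theta>] interior_subset by (intro closure_sequential[THEN iffD2]) blast
  moreover have "c \<notin> interior (effective_domain \<Lambda>)"
  proof
    assume "c \<in> interior (effective_domain \<Lambda>)"
    then obtain e where "0 < e" "ball c e \<subseteq> effective_domain \<Lambda>" by (auto simp: mem_interior)
    moreover from \<open>0 < e\<close> have "c + e / 2 \<in> ball c e" by (simp add: dist_real_def)
    ultimately show False using above[of "c + e / 2"] by auto
  qed
  ultimately have "c \<in> frontier (effective_domain \<Lambda>)" by (simp add: frontier_def)
  then have "filterlim (\<lambda>n. \<bar>deriv (\<lambda>\<theta>. real_of_ereal (\<Lambda> \<theta>)) (\<theta> n)\<bar>) at_top sequentially"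
    using ess_smooth below[OF \<theta>] lim unfolding essentially_smooth_def by blast
  then have "\<forall>\<^sub>F n in sequentially. y < \<bar>deriv (\<lambda>\<theta>. real_of_ereal (\<Lambda> \<theta>)) (\<theta> n)\<bar>"
    by (simp add: filterlim_at_top_dense)
  then obtain n where "y < \<bar>deriv (\<lambda>\<theta>. real_of_ereal (\<Lambda> \<theta>)) (\<theta> n)\<bar>"
    by (auto dest: eventually_happens)
  then show ?thesis using \<theta> below by blast
qed

lemma deriv_nonneg:
  assumes "0 \<le> \<eta>" "\<eta> \<in> interior (effective_domain \<Lambda>)"
  shows "0 \<le> deriv (\<lambda>\<theta>. real_of_ereal (\<Lambda> \<theta>)) \<eta>"
proof (rule ccontr)
  let ?g = "\<lambda>\<theta>. real_of_ereal (\<Lambda> \<theta>)"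
  assume "\<not> ?thesis"
  then obtain d where d: "0 < d" "\<And>h. 0 < h \<Longrightarrow> h < d \<Longrightarrow> ?g (\<eta> + h) < ?g \<eta>"
    using DERIV_neg_dec_right[OF has_derivative_interior[OF assms(2)]] by force
  obtain e where e: "0 < e" "ball \<eta> e \<subseteq> effective_domain \<Lambda>" using assms(2) by (auto simp: mem_interior)
  define h where "h = min d e / 2"
  have h: "0 < h" "h < d" "h < e" using d(1) e(1) by (auto simp: h_def)
  then have "\<eta> + h \<in> ball \<eta> e" by (simp add: dist_real_def)
  then have "\<Lambda> (\<eta> + h) < \<infinity>" using e by (auto simp: effective_domain_def)
  then have "?g \<eta> \<le> ?g (\<eta> + h)" using assms h by (intro real_mono) auto
  with d(2)[OF h(1,2)] show False by simp
qed

lemma zero_slope_at_zero: "DERIV (\<lambda>\<theta>. real_of_ereal (\<Lambda> \<theta>)) 0 :> 0"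
proof -
  let ?g = "\<lambda>\<theta>. real_of_ereal (\<Lambda> \<theta>)"
  obtain \<delta> where \<delta>: "0 < \<delta>" "\<Lambda> \<delta> < \<infinity>" using finite_near_zero by auto
  have D: "DERIV ?g 0 :> deriv ?g 0"
    using \<delta> by (intro has_derivative_interior interior_domainI[of 0 \<delta>]) auto
  have "deriv ?g 0 = 0"
    using D by (rule DERIV_local_min[of ?g _ 0 1])
      (use zero nonneg in \<open>auto simp: real_of_ereal_pos\<close>)
  with D show ?thesis by simp
qed

text \<open>A point of minimum of \<open>\<Lambda> \<theta> - y * \<theta>\<close> on \<open>[0, \<eta>1]\<close> has slope \<open>y\<close>, unless it is an end point. It
  is not: the derivative of that function is \<open>- y < 0\<close> at \<open>0\<close> and positive at \<open>\<eta>1\<close>.\<close>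

lemma slope_attained:
  assumes "0 < y" "0 \<le> \<eta>1" "\<eta>1 \<in> interior (effective_domain \<Lambda>)"
    "y < deriv (\<lambda>\<theta>. real_of_ereal (\<Lambda> \<theta>)) \<eta>1"
  shows "\<exists>\<eta>\<in>interior (effective_domain \<Lambda>). DERIV (\<lambda>\<theta>. real_of_ereal (\<Lambda> \<theta>)) \<eta> :> y"
proof -
  let ?D = "effective_domain \<Lambda>" and ?g = "\<lambda>\<theta>. real_of_ereal (\<Lambda> \<theta>)"
  define h where "h \<theta> = ?g \<theta> - y * \<theta>" for \<theta>
  have fin: "\<Lambda> \<eta>1 < \<infinity>" using assms(3) interior_subset by (auto simp: effective_domain_def)
  have int: "\<theta> \<in> interior ?D" if "0 \<le> \<theta>" "\<theta> \<le> \<eta>1" for \<theta>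
    using that assms(3) fin interior_domainI[of \<theta> \<eta>1] by (cases "\<theta> = \<eta>1") auto
  have D: "DERIV h \<theta> :> deriv ?g \<theta> - y" if "0 \<le> \<theta>" "\<theta> \<le> \<eta>1" for \<theta>
    unfolding h_def by (auto intro!: derivative_eq_intros has_derivative_interior int that)
  have g0: "deriv ?g 0 = 0" using zero_slope_at_zero by (rule DERIV_imp_deriv)
  have pos: "0 < \<eta>1" using assms g0 by (cases "\<eta>1 = 0") auto
  have "continuous_on {0..\<eta>1} h"
    using DERIV_isCont[OF D] by (intro continuous_at_imp_continuous_on) auto
  then obtain \<eta> where \<eta>: "\<eta> \<in> {0..\<eta>1}" "\<And>\<theta>. \<theta> \<in> {0..\<eta>1} \<Longrightarrow> h \<eta> \<le> h \<theta>"
    using continuous_attains_inf[of "{0..\<eta>1}" h] pos by auto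
  have "\<eta> \<noteq> 0"
  proof
    assume "\<eta> = 0"
    obtain d where d: "0 < d" "\<And>s. 0 < s \<Longrightarrow> s < d \<Longrightarrow> h (0 + s) < h 0"
      using DERIV_neg_dec_right[OF D[of 0]] pos assms(1) g0 by auto
    define s where "s = min d \<eta>1 / 2"
    have "0 < s" "s < d" "s \<le> \<eta>1" using d pos by (auto simp: s_def)
    then show False using d(2)[of s] \<eta>(2)[of s] \<open>\<eta> = 0\<close> by auto
  qed
  moreover have "\<eta> \<noteq> \<eta>1"
  proof
    assume "\<eta> = \<eta>1"
    obtain d where d: "0 < d" "\<And>s. 0 < s \<Longrightarrow> s < d \<Longrightarrow> h (\<eta>1 - s) < h \<eta>1"
      using DERIV_pos_inc_left[OF D[of \<eta>1]] pos assms(4) by auto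
    define s where "s = min d \<eta>1 / 2"
    have "0 < s" "s < d" "s \<le> \<eta>1" using d pos by (auto simp: s_def)
    then show False using d(2)[of s] \<eta>(2)[of "\<eta>1 - s"] \<open>\<eta> = \<eta>1\<close> by auto
  qed
  ultimately have \<eta>': "0 < \<eta>" "\<eta> < \<eta>1" using \<eta> by auto
  have "deriv ?g \<eta> - y = 0"
    using D[of \<eta>] by (rule DERIV_local_min[where d = "min \<eta> (\<eta>1 - \<eta>)"])
      (use \<eta>' in \<open>auto intro!: \<eta>(2) simp: abs_less_iff\<close>)
  then have "DERIV ?g \<eta> :> y" using has_derivative_interior[OF int, of \<eta>] \<eta>' by simp
  then show ?thesis using int[of \<eta>] \<eta>' by auto
qed

text \<open>Take a level \<open>y\<close> slightly below \<open>x\<close>. If no slope exceeded \<open>y\<close>, steepness would force \<open>\<Lambda>\<close> to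
  be finite on \<open>[0,\<infinity>)\<close>, the mean value theorem would give \<open>\<Lambda> \<theta> \<le> y * \<theta>\<close> there, and
  \<open>\<theta> * x - \<Lambda> \<theta> \<ge> (x - y) * \<theta>\<close> would make the Legendre transform infinite at \<open>x\<close>. So some slope
  exceeds \<open>y\<close>, and \<open>y\<close> is itself a slope. If \<open>x < \<epsilon>\<close>, the slope \<open>0\<close> at the minimum is close enough.\<close>

lemma slopes_dense_right:
  assumes "0 \<le> x" "legendre_transform \<Lambda> x < \<infinity>" "0 < \<epsilon>"
  shows "\<exists>\<eta>\<in>interior (effective_domain \<Lambda>). \<exists>y. DERIV (\<lambda>\<theta>. real_of_ereal (\<Lambda> \<theta>)) \<eta> :> y \<and>
    \<bar>y - x\<bar> < \<epsilon> \<and> legendre_transform \<Lambda> y \<le> legendre_transform \<Lambda> x"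
proof (cases "x < \<epsilon>")
  case True
  obtain \<delta> where \<delta>: "0 < \<delta>" "\<Lambda> \<delta> < \<infinity>" using finite_near_zero by auto
  show ?thesis
    using True \<delta> assms zero_slope_at_zero interior_domainI[of 0 \<delta>] legendre_nonneg[of x]
    by (intro bexI[of _ 0] exI[of _ 0]) (auto simp: legendre_zero)
next
  case False
  let ?D = "effective_domain \<Lambda>" and ?g = "\<lambda>\<theta>. real_of_ereal (\<Lambda> \<theta>)"
  define y where "y = x - \<epsilon> / 2"
  have y: "0 < y" "y < x" "\<bar>y - x\<bar> < \<epsilon>" using False assms by (auto simp: y_def)
  have "\<exists>\<eta>\<ge>0. \<eta> \<in> interior ?D \<and> y < deriv ?g \<eta>"
  proof (rule ccontr)
    assume "\<not> ?thesis"
    then have flat: "deriv ?g \<eta> \<le> y" if "0 \<le> \<eta>" "\<eta> \<in> interior ?D" for \<eta> using that by force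
    have fin: "\<Lambda> \<theta> < \<infinity>" if "0 \<le> \<theta>" for \<theta>
      using steep_right[of \<theta> y] flat deriv_nonneg that by (cases "\<Lambda> \<theta> = \<infinity>") force+
    have "ereal (\<theta> * (\<epsilon> / 2)) \<le> legendre_transform \<Lambda> x" if "0 < \<theta>" for \<theta>
    proof -
      note \<theta> = that
      have D: "DERIV ?g \<xi> :> deriv ?g \<xi>" "deriv ?g \<xi> \<le> y" if "0 \<le> \<xi>" for \<xi>
        using that fin interior_domainI[of \<xi> "\<xi> + 1"] flat
        by (auto intro: has_derivative_interior)
      obtain \<xi> where "0 < \<xi>" "\<xi> < \<theta>" "?g \<theta> - ?g 0 = (\<theta> - 0) * deriv ?g \<xi>"
        using MVT2[OF \<theta>, of ?g "deriv ?g"] D(1) by auto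
      then have "?g \<theta> \<le> \<theta> * y" using D(2)[of \<xi>] zero that by (simp add: mult_left_mono)
      then have "ereal (\<theta> * (\<epsilon> / 2)) \<le> ereal (\<theta> * x - ?g \<theta>)"
        by (simp add: y_def field_simps)
      also have "\<dots> = ereal (\<theta> * x) - \<Lambda> \<theta>"
        using ereal_real[OF fin, of \<theta>] that by (metis less_imp_le ereal_minus(1))
      also have "\<dots> \<le> legendre_transform \<Lambda> x" by (rule legendre_transform_ge)
      finally show ?thesis .
    qed
    moreover obtain r where r: "legendre_transform \<Lambda> x = ereal r" "0 \<le> r"
      using assms(2) legendre_nonneg[of x] by (cases "legendre_transform \<Lambda> x") auto
    ultimately have "\<theta> * (\<epsilon> / 2) \<le> r" if "0 < \<theta>" for \<theta> using that by (metis ereal_less_eq(3))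
    from this[of "(r + 1) / (\<epsilon> / 2)"] have "r + 1 \<le> r" using assms(3) r(2) by simp
    then show False by simp
  qed
  then obtain \<eta> where "\<eta> \<in> interior ?D" "DERIV ?g \<eta> :> y" using slope_attained[OF y(1)] by blast
  then show ?thesis using y legendre_mono[of y x] by (intro bexI[of _ \<eta>] exI[of _ y]) auto
qed

lemma slopes_dense:
  assumes "legendre_transform \<Lambda> x < \<infinity>" "0 < \<epsilon>"
  shows "\<exists>\<eta>\<in>interior (effective_domain \<Lambda>). \<exists>y. DERIV (\<lambda>\<theta>. real_of_ereal (\<Lambda> \<theta>)) \<eta> :> y \<and>
    \<bar>y - x\<bar> < \<epsilon> \<and> legendre_transform \<Lambda> y \<le> legendre_transform \<Lambda> x"
proof (cases "0 \<le> x")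
  case True
  then show ?thesis using slopes_dense_right assms by blast
next
  case False
  interpret R: unimodal_cgf "\<lambda>\<theta>. \<Lambda> (- \<theta>)" by (rule reflect)
  obtain \<eta> y where *: "\<eta> \<in> interior (effective_domain (\<lambda>\<theta>. \<Lambda> (- \<theta>)))"
    "DERIV (\<lambda>\<theta>. real_of_ereal (\<Lambda> (- \<theta>))) \<eta> :> y" "\<bar>y - - x\<bar> < \<epsilon>"
    "legendre_transform \<Lambda> (- y) \<le> legendre_transform \<Lambda> x"
    using R.slopes_dense_right[of "- x" \<epsilon>] False assms
    by (auto simp: legendre_transform_reflect)
  have "effective_domain (\<lambda>\<theta>. \<Lambda> (- \<theta>)) = uminus ` effective_domain \<Lambda>"
    unfolding effective_domain_def by (auto simp: image_iff intro!: exI[of _ "- _"])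
  then have "- \<eta> \<in> interior (effective_domain \<Lambda>)"
    using *(1) by (auto simp: interior_negations)
  moreover have "DERIV (\<lambda>\<theta>. real_of_ereal (\<Lambda> \<theta>)) (- \<eta>) :> - y"
    using *(2) DERIV_mirror[where f = "\<lambda>\<theta>. real_of_ereal (\<Lambda> \<theta>)" and x = \<eta> and y = "- y"] by simp
  ultimately show ?thesis using *(3,4) by (intro bexI[of _ "- \<eta>"] exI[of _ "- y"]) auto
qed

lemma closed_legendre_level: "closed {x. legendre_transform \<Lambda> x \<le> c}"
proof -
  have "{x. legendre_transform \<Lambda> x \<le> c} = (\<Inter>\<theta>. {x. ereal (\<theta> * x) - \<Lambda> \<theta> \<le> c})"
    unfolding legendre_transform_def by (auto simp: SUP_le_iff)
  moreover have "closed {x. ereal (\<theta> * x) - \<Lambda> \<theta> \<le> c}" for \<theta>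
  proof (cases "\<Lambda> \<theta>")
    case (real r)
    have "closed {x. ereal (\<theta> * x - r) \<le> c}"
      by (intro closed_Collect_le continuous_intros)
    then show ?thesis using real by simp
  qed (use nonneg[of \<theta>] in auto)
  ultimately show ?thesis by (simp add: closed_INT)
qed

lemma good_rate_function_legendre: "good_rate_function (legendre_transform \<Lambda>)"
  unfolding good_rate_function_def rate_function_def lower_semicontinuous_def
proof (intro conjI allI impI)
  show "0 \<le> legendre_transform \<Lambda> x" for x by (rule legendre_nonneg)
  show "legendre_transform \<Lambda> x \<le> Liminf (at x) (legendre_transform \<Lambda>)" for x
    unfolding le_Liminf_iff
  proof (intro allI impI)
    fix c assume "c < legendre_transform \<Lambda> x"
    then have "x \<in> - {x. legendre_transform \<Lambda> x \<le> c}" by simp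
    then have "\<forall>\<^sub>F z in at x. z \<in> - {x. legendre_transform \<Lambda> x \<le> c}"
      using closed_legendre_level by (intro eventually_at_topological[THEN iffD2]) blast
    then show "\<forall>\<^sub>F z in at x. c < legendre_transform \<Lambda> z" by eventually_elim auto
  qed
  fix b :: real assume "0 \<le> b"
  obtain \<delta> where \<delta>: "0 < \<delta>" "\<Lambda> \<delta> < \<infinity>" "\<Lambda> (- \<delta>) < \<infinity>" using finite_near_zero by auto
  let ?g = "\<lambda>\<theta>. real_of_ereal (\<Lambda> \<theta>)"
  have "\<bar>x\<bar> \<le> (b + ?g \<delta> + ?g (- \<delta>)) / \<delta>" if "legendre_transform \<Lambda> x \<le> ereal b" for x
  proof -
    have *: "\<theta> * x - ?g \<theta> \<le> b" if "\<Lambda> \<theta> < \<infinity>" for \<theta>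
    proof -
      have "ereal (\<theta> * x - ?g \<theta>) = ereal (\<theta> * x) - \<Lambda> \<theta>"
        using ereal_real[OF that] by (metis ereal_minus(1))
      also have "\<dots> \<le> ereal b" using legendre_transform_ge \<open>_ \<le> ereal b\<close> by (rule order_trans)
      finally show ?thesis by simp
    qed
    have "0 \<le> ?g \<delta>" "0 \<le> ?g (- \<delta>)" using nonneg by (auto simp: real_of_ereal_pos)
    then have "\<delta> * \<bar>x\<bar> \<le> b + ?g \<delta> + ?g (- \<delta>)"
      using *[OF \<delta>(2)] *[OF \<delta>(3)] by (auto simp: abs_if)
    then show ?thesis using \<delta>(1) by (simp add: field_simps)
  qed
  then have "bounded {x. legendre_transform \<Lambda> x \<le> ereal b}"
    unfolding bounded_iff by auto
  then show "compact {x. legendre_transform \<Lambda> x \<le> ereal b}"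
    using closed_legendre_level by (simp add: compact_eq_bounded_closed)
qed

end

section \<open>The Gartner-Ellis theorem for unimodal limits\<close>

text \<open>Convergence is required on the effective domain only: the upper bound draws no information
  from a \<open>\<theta>\<close> with infinite limit, and tilting takes place at interior points of the domain.\<close>

locale gartner_ellis = prob_space M + unimodal_cgf \<Lambda>
  for M :: "'a measure" and \<Lambda> :: "real \<Rightarrow> ereal" +
  fixes Z :: "real \<Rightarrow> 'a \<Rightarrow> real"
  assumes measurable_Z: "0 < t \<Longrightarrow> Z t \<in> borel_measurable M"
    and log_mgf_lim: "\<Lambda> \<theta> < \<infinity> \<Longrightarrow>
      ((\<lambda>t. log_mgf M (\<lambda>\<omega>. t * Z t \<omega>) \<theta> / ereal t) \<longlongrightarrow> \<Lambda> \<theta>) at_top"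
begin

abbreviation mgf :: "real \<Rightarrow> real \<Rightarrow> ennreal" where
  "mgf t \<theta> \<equiv> \<integral>\<^sup>+ \<omega>. ennreal (exp (\<theta> * (t * Z t \<omega>))) \<partial>M"

abbreviation event :: "real \<Rightarrow> real set \<Rightarrow> 'a set" where
  "event t A \<equiv> {\<omega> \<in> space M. Z t \<omega> \<in> A}"

lemma event_sets: "0 < t \<Longrightarrow> A \<in> sets borel \<Longrightarrow> event t A \<in> sets M"
  using measurable_sets[OF measurable_Z, of t A] by (simp add: vimage_def Int_def conj_commute)

lemma reflected: "gartner_ellis M (\<lambda>\<theta>. \<Lambda> (- \<theta>)) (\<lambda>t \<omega>. - Z t \<omega>)"
proof -
  interpret R: unimodal_cgf "\<lambda>\<theta>. \<Lambda> (- \<theta>)" by (rule reflect)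
  show ?thesis
  proof
    show "((\<lambda>t. log_mgf M (\<lambda>\<omega>. t * - Z t \<omega>) \<theta> / ereal t) \<longlongrightarrow> \<Lambda> (- \<theta>)) at_top"
      if "\<Lambda> (- \<theta>) < \<infinity>" for \<theta>
      using log_mgf_lim[OF that] by (simp add: log_mgf_def)
  qed (use measurable_Z in auto)
qed

lemma mgf_bounds:
  assumes "\<Lambda> \<theta> < \<infinity>" "0 < e"
  shows "\<forall>\<^sub>F t in at_top. ennreal (exp ((real_of_ereal (\<Lambda> \<theta>) - e) * t)) \<le> mgf t \<theta> \<and>
    mgf t \<theta> \<le> ennreal (exp ((real_of_ereal (\<Lambda> \<theta>) + e) * t))"
proof -
  have "((\<lambda>t. ext_ln (mgf t \<theta>) / ereal t) \<longlongrightarrow> ereal (real_of_ereal (\<Lambda> \<theta>))) at_top"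
    using log_mgf_lim[OF assms(1)] ereal_real[OF assms(1)] by (simp add: log_mgf_def)
  then show ?thesis using assms(2) unfolding tendsto_ext_ln_div_iff by blast
qed

lemma prob_le_exp: "0 < r \<Longrightarrow> \<forall>\<^sub>F t in at_top. emeasure M (event t A) \<le> ennreal (exp (r * t))"
  using eventually_ge_at_top[of 0]
proof eventually_elim
  case (elim t)
  have "emeasure M (event t A) \<le> ennreal 1" by (simp add: emeasure_eq_measure)
  also have "\<dots> \<le> ennreal (exp (r * t))" using elim by (intro ennreal_leI) simp
  finally show ?case .
qed

lemma chernoff:
  assumes "0 < t" "0 \<le> \<theta>"
  shows "emeasure M (event t {b..}) \<le> ennreal (exp (- (\<theta> * b * t))) * mgf t \<theta>"
proof -
  have [measurable]: "Z t \<in> borel_measurable M" using assms measurable_Z by simp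
  have "emeasure M (event t {b..}) = (\<integral>\<^sup>+ \<omega>. indicator (event t {b..}) \<omega> \<partial>M)"
    by (subst nn_integral_indicator) (auto intro: event_sets assms)
  also have "\<dots> \<le> (\<integral>\<^sup>+ \<omega>. ennreal (exp (- (\<theta> * b * t))) * ennreal (exp (\<theta> * (t * Z t \<omega>))) \<partial>M)"
  proof (rule nn_integral_mono)
    fix \<omega>
    show "indicator (event t {b..}) \<omega> \<le> ennreal (exp (- (\<theta> * b * t))) * ennreal (exp (\<theta> * (t * Z t \<omega>)))"
    proof (cases "\<omega> \<in> event t {b..}")
      case True
      then have "0 \<le> \<theta> * t * (Z t \<omega> - b)" using assms by simp
      then have "1 \<le> exp (- (\<theta> * b * t)) * exp (\<theta> * (t * Z t \<omega>))"
        unfolding exp_add[symmetric] by (simp add: algebra_simps)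
      from ennreal_leI[OF this] show ?thesis using True by (simp add: ennreal_mult)
    qed simp
  qed
  also have "\<dots> = ennreal (exp (- (\<theta> * b * t))) * mgf t \<theta>"
    by (rule nn_integral_cmult) simp
  finally show ?thesis .
qed

text \<open>Since \<open>\<Lambda> \<ge> 0\<close>, a \<open>\<theta>\<close> that witnesses a positive value of the Legendre transform at \<open>b > 0\<close> is
  positive, hence Chernoff's inequality for the event \<open>Z \<ge> b\<close> attains the full rate.\<close>

lemma upper_bound_ray:
  assumes "0 < b" "- legendre_transform \<Lambda> b < ereal r"
  shows "\<forall>\<^sub>F t in at_top. emeasure M (event t {b..}) \<le> ennreal (exp (r * t))"
proof (cases "0 < r")
  case True
  then show ?thesis by (rule prob_le_exp)
next
  case False
  have "ereal (- r) < legendre_transform \<Lambda> b" using assms(2) by (simp add: ereal_uminus_less_reorder)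
  then obtain \<theta> where \<theta>: "ereal (- r) < ereal (\<theta> * b) - \<Lambda> \<theta>"
    unfolding legendre_transform_def less_SUP_iff by auto
  then have fin: "\<Lambda> \<theta> < \<infinity>" by auto
  define g where "g = real_of_ereal (\<Lambda> \<theta>)"
  have g: "\<Lambda> \<theta> = ereal g" unfolding g_def using fin by (rule ereal_real)
  have g0: "0 \<le> g" using nonneg[of \<theta>] g by simp
  define e where "e = \<theta> * b - g + r"
  have e: "0 < e" using \<theta> g by (simp add: e_def)
  have "0 < \<theta> * b" using e g0 False by (simp add: e_def)
  then have "0 \<le> \<theta>" using assms(1) by (simp add: zero_less_mult_iff)
  show ?thesis
    using mgf_bounds[OF fin e] eventually_gt_at_top[of 0]
  proof eventually_elim
    case (elim t)
    have "emeasure M (event t {b..}) \<le> ennreal (exp (- (\<theta> * b * t))) * mgf t \<theta>"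
      using elim \<open>0 \<le> \<theta>\<close> by (intro chernoff)
    also have "\<dots> \<le> ennreal (exp (- (\<theta> * b * t))) * ennreal (exp ((g + e) * t))"
      using elim by (intro mult_left_mono) (auto simp: g_def)
    also have "\<dots> = ennreal (exp (r * t))"
      by (simp add: ennreal_mult[symmetric] exp_add[symmetric]) (simp add: e_def algebra_simps)
    finally show ?case .
  qed
qed

text \<open>The part of \<open>C\<close> to the right of \<open>0\<close> lies in the ray that starts at its smallest element \<open>b\<close>,
  and \<open>b\<close> belongs to \<open>C\<close>, so the rate at \<open>b\<close> is one of those over which the infimum is taken.\<close>

lemma upper_bound_right:
  assumes "closed C" "0 \<notin> C" "\<And>x. x \<in> C \<Longrightarrow> - legendre_transform \<Lambda> x < ereal r"
  shows "\<forall>\<^sub>F t in at_top. emeasure M (event t (C \<inter> {0..})) \<le> ennreal (exp (r * t))"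
proof (cases "C \<inter> {0..} = {}")
  case False
  define b where "b = Inf (C \<inter> {0..})"
  have bdd: "bdd_below (C \<inter> {0..})" by (rule bdd_belowI[of _ 0]) auto
  have "b \<in> C \<inter> {0..}"
    unfolding b_def using assms(1) False bdd by (intro closed_contains_Inf) auto
  then have b: "b \<in> C" "0 < b" using assms(2) by (auto simp: order_le_less)
  have sub: "C \<inter> {0..} \<subseteq> {b..}" unfolding b_def using bdd by (auto intro: cInf_lower)
  show ?thesis
    using upper_bound_ray[OF b(2) assms(3)[OF b(1)]] eventually_gt_at_top[of 0]
  proof eventually_elim
    case (elim t)
    have "emeasure M (event t (C \<inter> {0..})) \<le> emeasure M (event t {b..})"
      using sub elim by (intro emeasure_mono event_sets) auto
    with elim show ?case by (meson order_trans)
  qed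
qed simp

lemma upper_bound:
  assumes "closed C"
  shows "Limsup at_top (\<lambda>t. ext_ln (emeasure M (event t C)) / ereal t)
    \<le> - (INF x\<in>C. legendre_transform \<Lambda> x)"
proof (rule Limsup_ext_ln_div_le)
  fix r assume r: "- (INF x\<in>C. legendre_transform \<Lambda> x) < ereal r"
  show "\<forall>\<^sub>F t in at_top. emeasure M (event t C) \<le> ennreal (exp (r * t))"
  proof (cases "0 \<in> C")
    case True
    then have "(INF x\<in>C. legendre_transform \<Lambda> x) \<le> 0" using legendre_zero by (metis INF_lower)
    then have "0 \<le> - (INF x\<in>C. legendre_transform \<Lambda> x)" by simp
    then have "0 < r" using r by (metis ereal_less(2) le_less_trans)
    then show ?thesis by (rule prob_le_exp)
  next
    case False
    obtain r' where r': "- (INF x\<in>C. legendre_transform \<Lambda> x) < ereal r'" "r' < r"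
      using ereal_dense2[OF r] by auto
    have *: "- legendre_transform \<Lambda> x < ereal r'" if "x \<in> C" for x
      using INF_lower[OF that, of "legendre_transform \<Lambda>"] r'(1) by (meson ereal_minus_le_minus le_less_trans)
    interpret R: gartner_ellis M "\<lambda>\<theta>. \<Lambda> (- \<theta>)" "\<lambda>t \<omega>. - Z t \<omega>" by (rule reflected)
    have right: "\<forall>\<^sub>F t in at_top. emeasure M (event t (C \<inter> {0..})) \<le> ennreal (exp (r' * t))"
      using assms False * by (rule upper_bound_right)
    have "\<forall>\<^sub>F t in at_top. emeasure M (R.event t (uminus ` C \<inter> {0..})) \<le> ennreal (exp (r' * t))"
      using assms False * by (intro R.upper_bound_right closed_negations)
        (auto simp: legendre_transform_reflect)
    moreover have "R.event t (uminus ` C \<inter> {0..}) = event t (C \<inter> {..0})" for t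
      by (auto simp: image_iff minus_equation_iff)
    ultimately have left: "\<forall>\<^sub>F t in at_top. emeasure M (event t (C \<inter> {..0})) \<le> ennreal (exp (r' * t))"
      by simp
    have "\<forall>\<^sub>F t in at_top. 2 \<le> exp ((r - r') * t)" using r' by (intro eventually_const_le_exp) simp
    then show ?thesis using left right eventually_gt_at_top[of 0]
    proof eventually_elim
      case (elim t)
      have "emeasure M (event t C) \<le> emeasure M (event t (C \<inter> {0..}) \<union> event t (C \<inter> {..0}))"
        using elim assms by (intro emeasure_mono sets.Un event_sets) auto
      also have "\<dots> \<le> emeasure M (event t (C \<inter> {0..})) + emeasure M (event t (C \<inter> {..0}))"
        using elim assms by (intro emeasure_subadditive event_sets) auto
      also have "\<dots> \<le> ennreal (exp (r' * t)) + ennreal (exp (r' * t))"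
        using elim by (intro add_mono)
      also have "\<dots> = ennreal (2 * exp (r' * t))" by (simp flip: ennreal_plus)
      also have "\<dots> \<le> ennreal (exp (r * t))"
      proof (rule ennreal_leI)
        have "2 * exp (r' * t) \<le> exp ((r - r') * t) * exp (r' * t)"
          using elim by (intro mult_right_mono) auto
        then show "2 * exp (r' * t) \<le> exp (r * t)"
          by (simp add: exp_add[symmetric] algebra_simps)
      qed
      finally show ?case .
    qed
  qed
qed

text \<open>The integral defining \<open>mgf t \<eta>\<close> is split according to whether \<open>Z\<close> lies in the ball around \<open>y\<close>,
  above it or below it. Inside the ball the integrand is bounded by a constant; on the two outer parts
  it is dominated by the integrands for the parameters \<open>\<eta> + s\<close> and \<open>\<eta> - s\<close>.\<close>

lemma tilting:
  assumes t: "0 < t" and "0 \<le> s" "0 < \<delta>"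
  shows "mgf t \<eta> \<le> ennreal (exp ((\<eta> * y + \<bar>\<eta>\<bar> * \<delta>) * t)) * emeasure M (event t (ball y \<delta>))
    + ennreal (exp (- s * (y + \<delta>) * t)) * mgf t (\<eta> + s)
    + ennreal (exp (s * (y - \<delta>) * t)) * mgf t (\<eta> - s)"
proof -
  have [measurable]: "Z t \<in> borel_measurable M" using assms measurable_Z by simp
  have [measurable]: "event t (ball y \<delta>) \<in> sets M" using t by (intro event_sets) auto
  let ?a = "ennreal (exp ((\<eta> * y + \<bar>\<eta>\<bar> * \<delta>) * t))"
  let ?b = "ennreal (exp (- s * (y + \<delta>) * t))" and ?c = "ennreal (exp (s * (y - \<delta>) * t))"
  let ?m = "\<lambda>\<theta> \<omega>. ennreal (exp (\<theta> * (t * Z t \<omega>)))"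
  have "mgf t \<eta> \<le> (\<integral>\<^sup>+ \<omega>. (?a * indicator (event t (ball y \<delta>)) \<omega> + ?b * ?m (\<eta> + s) \<omega>) + ?c * ?m (\<eta> - s) \<omega> \<partial>M)"
  proof (rule nn_integral_mono)
    fix \<omega> assume \<omega>: "\<omega> \<in> space M"
    let ?i = "indicator (event t (ball y \<delta>)) \<omega> :: ennreal"
    consider "\<bar>Z t \<omega> - y\<bar> < \<delta>" | "y + \<delta> \<le> Z t \<omega>" | "Z t \<omega> \<le> y - \<delta>" by linarith
    then show "?m \<eta> \<omega> \<le> (?a * ?i + ?b * ?m (\<eta> + s) \<omega>) + ?c * ?m (\<eta> - s) \<omega>"
    proof cases
      case 1
      have "\<eta> * (Z t \<omega> - y) \<le> \<bar>\<eta>\<bar> * \<bar>Z t \<omega> - y\<bar>" by (metis abs_ge_self abs_mult)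
      also have "\<dots> \<le> \<bar>\<eta>\<bar> * \<delta>" using 1 by (intro mult_left_mono) auto
      finally have "\<eta> * Z t \<omega> * t \<le> (\<eta> * y + \<bar>\<eta>\<bar> * \<delta>) * t"
        using t by (intro mult_right_mono) (auto simp: algebra_simps)
      then have "?m \<eta> \<omega> \<le> ?a" by (intro ennreal_leI) (simp add: mult_ac)
      also have "\<dots> = ?a * ?i" using 1 \<omega> by (simp add: dist_real_def abs_minus_commute)
      finally show ?thesis by (simp add: add.assoc add_increasing2)
    next
      case 2
      have "0 \<le> s * t * (Z t \<omega> - (y + \<delta>))" using 2 assms by simp
      then have "?m \<eta> \<omega> \<le> ennreal (exp (- s * (y + \<delta>) * t + (\<eta> + s) * (t * Z t \<omega>)))"
        by (intro ennreal_leI) (simp add: algebra_simps)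
      also have "\<dots> = ?b * ?m (\<eta> + s) \<omega>" by (simp only: exp_add ennreal_mult' exp_ge_zero)
      finally show ?thesis by (meson add_increasing add_increasing2 zero_le)
    next
      case 3
      have "0 \<le> s * t * ((y - \<delta>) - Z t \<omega>)" using 3 assms by simp
      then have "?m \<eta> \<omega> \<le> ennreal (exp (s * (y - \<delta>) * t + (\<eta> - s) * (t * Z t \<omega>)))"
        by (intro ennreal_leI) (simp add: algebra_simps)
      also have "\<dots> = ?c * ?m (\<eta> - s) \<omega>" by (simp only: exp_add ennreal_mult' exp_ge_zero)
      finally show ?thesis by (meson add_increasing zero_le)
    qed
  qed
  also have "\<dots> = ?a * emeasure M (event t (ball y \<delta>)) + ?b * mgf t (\<eta> + s) + ?c * mgf t (\<eta> - s)"
    by (simp add: nn_integral_add nn_integral_cmult)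
  finally show ?thesis .
qed

text \<open>If \<open>\<Lambda>\<close> has slope \<open>y\<close> at \<open>\<eta>\<close>, then for small \<open>s\<close> the outer parts in the decomposition of \<open>mgf t \<eta>\<close>
  have growth rate at most \<open>\<Lambda> (\<eta> \<plusminus> s) \<mp> s * y - s * \<delta> \<le> \<Lambda> \<eta> - s * \<delta> / 2\<close>, strictly less than that of
  \<open>mgf t \<eta>\<close> itself. So the ball carries almost all of the tilted mass. In terms of measures: under the
  exponentially tilted law, \<open>Z\<close> concentrates at \<open>y\<close>.\<close>

lemma lower_bound_ball:
  assumes \<eta>: "\<eta> \<in> interior (effective_domain \<Lambda>)"
    and deriv: "DERIV (\<lambda>\<theta>. real_of_ereal (\<Lambda> \<theta>)) \<eta> :> y"
    and \<delta>: "0 < \<delta>" and r: "r < real_of_ereal (\<Lambda> \<eta>) - \<eta> * y - \<bar>\<eta>\<bar> * \<delta>"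
  shows "\<forall>\<^sub>F t in at_top. ennreal (exp (r * t)) \<le> emeasure M (event t (ball y \<delta>))"
proof -
  define g where "g \<theta> = real_of_ereal (\<Lambda> \<theta>)" for \<theta>
  obtain d1 where d1: "0 < d1" "ball \<eta> d1 \<subseteq> effective_domain \<Lambda>" using \<eta> by (auto simp: mem_interior)
  have "(\<lambda>h. (g (\<eta> + h) - g \<eta>) / h) \<midarrow>0\<rightarrow> y" using deriv by (simp add: DERIV_def g_def)
  then obtain d2 where d2: "0 < d2"
    "\<And>h. h \<noteq> 0 \<Longrightarrow> \<bar>h\<bar> < d2 \<Longrightarrow> \<bar>(g (\<eta> + h) - g \<eta>) / h - y\<bar> < \<delta> / 2"
    using LIM_D[of _ y 0 "\<delta> / 2"] \<delta> by force
  define s where "s = min d1 d2 / 2"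
  have s: "0 < s" "s < d1" "s < d2" using d1 d2 by (auto simp: s_def)
  have near: "\<Lambda> (\<eta> + h) < \<infinity>" "g (\<eta> + h) \<le> g \<eta> + h * y + s * \<delta> / 2" if "\<bar>h\<bar> = s" for h
  proof -
    have "\<eta> + h \<in> ball \<eta> d1" using s that by (simp add: dist_real_def)
    then show "\<Lambda> (\<eta> + h) < \<infinity>" using d1 by (auto simp: effective_domain_def)
    have h: "h \<noteq> 0" using that s by auto
    have "g (\<eta> + h) - g \<eta> - h * y = h * ((g (\<eta> + h) - g \<eta>) / h - y)"
      using h by (simp add: field_simps)
    then have "\<bar>g (\<eta> + h) - g \<eta> - h * y\<bar> = \<bar>h\<bar> * \<bar>(g (\<eta> + h) - g \<eta>) / h - y\<bar>"
      by (simp add: abs_mult)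
    also have "\<dots> \<le> s * (\<delta> / 2)"
      unfolding that using d2(2)[OF h] s that by (intro mult_left_mono) auto
    finally have "\<bar>g (\<eta> + h) - g \<eta> - h * y\<bar> \<le> s * \<delta> / 2" by simp
    then show "g (\<eta> + h) \<le> g \<eta> + h * y + s * \<delta> / 2" by linarith
  qed
  have fin: "\<Lambda> \<eta> < \<infinity>" using \<eta> interior_subset by (auto simp: effective_domain_def)
  have fin1: "\<Lambda> (\<eta> + s) < \<infinity>" "g (\<eta> + s) \<le> g \<eta> + s * y + s * \<delta> / 2"
    and fin2: "\<Lambda> (\<eta> - s) < \<infinity>" "g (\<eta> - s) \<le> g \<eta> - s * y + s * \<delta> / 2"
    using near[of s] near[of "- s"] s by auto
  define K where "K = \<eta> * y + \<bar>\<eta>\<bar> * \<delta>"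
  \<comment> \<open>the outer parts then have rate at most \<open>g \<eta> - 3 * e\<close>, whereas \<open>mgf t \<eta>\<close> has rate at least
    \<open>g \<eta> - e\<close>; a further \<open>e\<close> absorbs the constant factors\<close>
  define e where "e = min (s * \<delta> / 8) ((g \<eta> - K - r) / 2)"
  have "e \<le> s * \<delta> / 8" "e \<le> (g \<eta> - K - r) / 2"
    unfolding e_def by (rule min.cobounded1 min.cobounded2)+
  moreover have "0 < e" using s \<delta> r by (simp add: e_def K_def g_def)
  ultimately have e: "0 < e" "4 * e \<le> s * \<delta> / 2" "r \<le> g \<eta> - K - 2 * e" by simp_all
  have "\<forall>\<^sub>F t in at_top. 4 \<le> exp (e * t)" using e(1) by (rule eventually_const_le_exp)
  then show ?thesis
    using mgf_bounds[OF fin e(1)] mgf_bounds[OF fin1(1) e(1)] mgf_bounds[OF fin2(1) e(1)]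
      eventually_gt_at_top[of 0]
  proof eventually_elim
    case (elim t)
    define p where "p = prob (event t (ball y \<delta>))"
    have p: "0 \<le> p" by (simp add: p_def)
    have "ennreal (exp (- s * (y + \<delta>) * t)) * mgf t (\<eta> + s)
        \<le> ennreal (exp (- s * (y + \<delta>) * t)) * ennreal (exp ((g (\<eta> + s) + e) * t))"
      using elim by (intro mult_left_mono) (auto simp: g_def)
    also have "\<dots> = ennreal (exp ((- s * (y + \<delta>) + (g (\<eta> + s) + e)) * t))"
      by (simp add: ennreal_mult[symmetric] exp_add[symmetric]) (simp add: algebra_simps)
    also have "\<dots> \<le> ennreal (exp ((g \<eta> - 3 * e) * t))"
      using fin1(2) e elim by (intro ennreal_leI exp_le_cancel_iff[THEN iffD2] mult_right_mono)
        (auto simp: algebra_simps)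
    finally have right: "ennreal (exp (- s * (y + \<delta>) * t)) * mgf t (\<eta> + s)
      \<le> ennreal (exp ((g \<eta> - 3 * e) * t))" .
    have "ennreal (exp (s * (y - \<delta>) * t)) * mgf t (\<eta> - s)
        \<le> ennreal (exp (s * (y - \<delta>) * t)) * ennreal (exp ((g (\<eta> - s) + e) * t))"
      using elim by (intro mult_left_mono) (auto simp: g_def)
    also have "\<dots> = ennreal (exp ((s * (y - \<delta>) + (g (\<eta> - s) + e)) * t))"
      by (simp add: ennreal_mult[symmetric] exp_add[symmetric]) (simp add: algebra_simps)
    also have "\<dots> \<le> ennreal (exp ((g \<eta> - 3 * e) * t))"
      using fin2(2) e elim by (intro ennreal_leI exp_le_cancel_iff[THEN iffD2] mult_right_mono)
        (auto simp: algebra_simps)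
    finally have left: "ennreal (exp (s * (y - \<delta>) * t)) * mgf t (\<eta> - s)
      \<le> ennreal (exp ((g \<eta> - 3 * e) * t))" .
    have "ennreal (exp ((g \<eta> - e) * t)) \<le> mgf t \<eta>" using elim by (simp add: g_def)
    also have "\<dots> \<le> ennreal (exp (K * t)) * ennreal p
        + ennreal (exp (- s * (y + \<delta>) * t)) * mgf t (\<eta> + s)
        + ennreal (exp (s * (y - \<delta>) * t)) * mgf t (\<eta> - s)"
      using tilting[of t s \<delta> \<eta> y] elim s \<delta> by (simp add: K_def p_def emeasure_eq_measure)
    also have "\<dots> \<le> ennreal (exp (K * t)) * ennreal p
        + ennreal (exp ((g \<eta> - 3 * e) * t)) + ennreal (exp ((g \<eta> - 3 * e) * t))"
      using left right by (intro add_mono order_refl)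
    also have "\<dots> = ennreal (exp (K * t) * p + exp ((g \<eta> - 3 * e) * t) + exp ((g \<eta> - 3 * e) * t))"
      by (simp only: ennreal_mult ennreal_plus p exp_ge_zero add_nonneg_nonneg mult_nonneg_nonneg)
    finally have main: "exp ((g \<eta> - e) * t) \<le> exp (K * t) * p + 2 * exp ((g \<eta> - 3 * e) * t)"
      by (subst (asm) ennreal_le_iff) (auto simp: p_def)
    define u where "u = exp (e * t)"
    have u: "4 \<le> u" using elim by (simp add: u_def)
    have "exp ((g \<eta> - e) * t) = exp ((g \<eta> - 3 * e) * t) * u\<^sup>2"
      and "exp ((g \<eta> - 2 * e) * t) = exp ((g \<eta> - 3 * e) * t) * u"
      by (simp_all add: u_def power2_eq_square exp_add[symmetric] algebra_simps)
    moreover have "exp ((g \<eta> - 3 * e) * t) * (u + 2) \<le> exp ((g \<eta> - 3 * e) * t) * u\<^sup>2"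
    proof (intro mult_left_mono)
      have "4 * u \<le> u * u" using u by (intro mult_right_mono) auto
      then show "u + 2 \<le> u\<^sup>2" unfolding power2_eq_square using u by linarith
    qed simp
    ultimately have "exp ((g \<eta> - 2 * e) * t) \<le> exp (K * t) * p"
      using main by (simp add: algebra_simps)
    then have "exp ((g \<eta> - 2 * e) * t) * exp (- K * t) \<le> p"
      by (simp add: exp_minus field_simps)
    moreover have "exp (r * t) \<le> exp ((g \<eta> - K - 2 * e) * t)"
      using e(3) elim by (simp add: mult_right_mono)
    moreover have "exp ((g \<eta> - K - 2 * e) * t) = exp ((g \<eta> - 2 * e) * t) * exp (- K * t)"
      by (simp add: exp_add[symmetric] algebra_simps)
    ultimately have "exp (r * t) \<le> p" by simp
    then show ?case by (simp add: p_def emeasure_eq_measure ennreal_leI)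
  qed
qed

lemma lower_bound:
  assumes "open G"
  shows "- (INF x\<in>G. legendre_transform \<Lambda> x)
    \<le> Liminf at_top (\<lambda>t. ext_ln (emeasure M (event t G)) / ereal t)"
proof (rule Liminf_ext_ln_div_ge)
  fix r assume "ereal r < - (INF x\<in>G. legendre_transform \<Lambda> x)"
  then have "(INF x\<in>G. legendre_transform \<Lambda> x) < - ereal r" by (subst ereal_less_uminus_reorder)
  then have "(INF x\<in>G. legendre_transform \<Lambda> x) < ereal (- r)" by simp
  then obtain x where x: "x \<in> G" "legendre_transform \<Lambda> x < ereal (- r)" by (auto simp: INF_less_iff)
  obtain \<epsilon> where \<epsilon>: "0 < \<epsilon>" "ball x \<epsilon> \<subseteq> G" using assms x(1) open_contains_ball by blast
  have "legendre_transform \<Lambda> x < \<infinity>" using x(2) by auto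
  then obtain \<eta> y where \<eta>: "\<eta> \<in> interior (effective_domain \<Lambda>)"
      "DERIV (\<lambda>\<theta>. real_of_ereal (\<Lambda> \<theta>)) \<eta> :> y" "\<bar>y - x\<bar> < \<epsilon> / 2"
      "legendre_transform \<Lambda> y \<le> legendre_transform \<Lambda> x"
    using slopes_dense[of x "\<epsilon> / 2"] \<epsilon>(1) by auto
  define q where "q = real_of_ereal (\<Lambda> \<eta>) - \<eta> * y - r"
  have fin: "\<Lambda> \<eta> < \<infinity>" using \<eta>(1) interior_subset by (auto simp: effective_domain_def)
  have "ereal (\<eta> * y - real_of_ereal (\<Lambda> \<eta>)) = ereal (\<eta> * y) - \<Lambda> \<eta>"
    using ereal_real[OF fin] by (metis ereal_minus(1))
  also have "\<dots> \<le> legendre_transform \<Lambda> y" by (rule legendre_transform_ge)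
  also have "\<dots> < ereal (- r)" using \<eta>(4) x(2) by (rule le_less_trans)
  finally have q: "0 < q" by (simp add: q_def)
  define \<delta> where "\<delta> = min (\<epsilon> / 2) (q / (\<bar>\<eta>\<bar> + 1))"
  have \<delta>: "0 < \<delta>" using \<epsilon> q by (simp add: \<delta>_def)
  have "\<bar>\<eta>\<bar> * \<delta> < (\<bar>\<eta>\<bar> + 1) * \<delta>" using \<delta> by simp
  also have "\<dots> \<le> (\<bar>\<eta>\<bar> + 1) * (q / (\<bar>\<eta>\<bar> + 1))" by (intro mult_left_mono) (auto simp: \<delta>_def)
  also have "\<dots> = q" by (simp add: add_nonneg_pos)
  finally have "r < real_of_ereal (\<Lambda> \<eta>) - \<eta> * y - \<bar>\<eta>\<bar> * \<delta>" by (simp add: q_def)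
  from lower_bound_ball[OF \<eta>(1,2) \<delta> this]
  show "\<forall>\<^sub>F t in at_top. ennreal (exp (r * t)) \<le> emeasure M (event t G)"
    using eventually_gt_at_top[of 0]
  proof eventually_elim
    case (elim t)
    have "ball y \<delta> \<subseteq> ball x \<epsilon>"
    proof
      fix z assume "z \<in> ball y \<delta>"
      then have "dist y z < \<epsilon> / 2" by (simp add: \<delta>_def)
      moreover have "dist x y < \<epsilon> / 2" using \<eta>(3) by (simp add: dist_real_def abs_minus_commute)
      ultimately show "z \<in> ball x \<epsilon>" using dist_triangle[of x z y] by simp
    qed
    then have "emeasure M (event t (ball y \<delta>)) \<le> emeasure M (event t G)"
      using \<epsilon>(2) elim assms by (intro emeasure_mono event_sets) auto
    with elim show ?case by (meson order_trans)
  qed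
qed

theorem LDP: "satisfies_LDP M Z (\<lambda>t. t) (legendre_transform \<Lambda>)"
  unfolding satisfies_LDP_def
  using measurable_Z upper_bound lower_bound good_rate_function_legendre
  by (auto simp: good_rate_function_def filterlim_ident)

end

section \<open>Moments and measurability of time-changed processes\<close>

lemma borel_measurable_completion_AE:
  assumes "g \<in> borel_measurable M" "AE \<omega> in M. f \<omega> = g \<omega>"
  shows "f \<in> borel_measurable (completion M)"
proof (rule measurableI)
  fix A :: "'b set" assume A: "A \<in> sets borel"
  show "f -` A \<inter> space (completion M) \<in> sets (completion M)"
  proof (rule completion.in_sets_AE)
    show "g -` A \<inter> space M \<in> sets (completion M)" using assms(1) A by (simp add: measurable_sets)
    show "AE \<omega> in completion M. \<omega> \<in> g -` A \<inter> space M \<longleftrightarrow> \<omega> \<in> f -` A \<inter> space (completion M)"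
      using assms(2) by (intro AE_completion) auto
  qed simp
qed simp

lemma nn_integral_nat_valued:
  assumes F: "\<And>i::nat. F i \<in> borel_measurable M" and N: "N \<in> measurable M (count_space UNIV)"
  shows "(\<integral>\<^sup>+ \<omega>. F (N \<omega>) \<omega> \<partial>M) = (\<Sum>i. \<integral>\<^sup>+ \<omega>. indicator {i} (N \<omega>) * F i \<omega> \<partial>M)"
proof -
  have "(\<lambda>\<omega>. indicator {i} (N \<omega>) * F i \<omega>) \<in> borel_measurable M" for i
    by (intro borel_measurable_times_ennreal F measurable_compose[OF N]) simp
  then have "(\<integral>\<^sup>+ \<omega>. (\<Sum>i. indicator {i} (N \<omega>) * F i \<omega>) \<partial>M) = (\<Sum>i. \<integral>\<^sup>+ \<omega>. indicator {i} (N \<omega>) * F i \<omega> \<partial>M)"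
    by (rule nn_integral_suminf)
  moreover have "(\<Sum>i. indicator {i} (N \<omega>) * F i \<omega>) = F (N \<omega>) \<omega>" for \<omega>
    by (subst suminf_finite[of "{N \<omega>}"]) auto
  ultimately show ?thesis by simp
qed

lemma path_eval:
  assumes "0 \<le> t" "f \<in> borel_measurable borel"
  shows "(\<lambda>p. f (p t)) \<in> borel_measurable path_space"
  using assms by (intro measurable_compose[OF measurable_component_singleton]) auto

lemma same_law_nn_integral:
  assumes "same_law N X M Y" "0 \<le> t" "f \<in> borel_measurable borel"
    "\<And>t. 0 \<le> t \<Longrightarrow> X t \<in> borel_measurable N" "\<And>t. 0 \<le> t \<Longrightarrow> Y t \<in> borel_measurable M"
  shows "(\<integral>\<^sup>+ \<omega>. f (X t \<omega>) \<partial>N) = (\<integral>\<^sup>+ \<omega>. f (Y t \<omega>) \<partial>M)"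
proof -
  have X: "path X \<in> measurable N path_space" and Y: "path Y \<in> measurable M path_space"
    unfolding path_def[abs_def] using assms(4,5) by (auto intro: measurable_restrict)
  have "(\<integral>\<^sup>+ p. f (p t) \<partial>distr N path_space (path X)) = (\<integral>\<^sup>+ p. f (p t) \<partial>distr M path_space (path Y))"
    using assms(1) by (simp add: same_law_def)
  then show ?thesis
    using assms(2) by (simp add: nn_integral_distr[OF X] nn_integral_distr[OF Y] path_eval[OF assms(2,3)] path_def)
qed

context prob_space
begin

lemma indep_var_nn_integral_mult:
  assumes "indep_var N1 X N2 Y" "f \<in> borel_measurable N1" "g \<in> borel_measurable N2"
  shows "(\<integral>\<^sup>+ \<omega>. f (X \<omega>) * g (Y \<omega>) \<partial>M) = (\<integral>\<^sup>+ \<omega>. f (X \<omega>) \<partial>M) * (\<integral>\<^sup>+ \<omega>. g (Y \<omega>) \<partial>M)"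
proof -
  have [measurable]: "random_variable N1 X" "random_variable N2 Y"
    and eq: "distr M (N1 \<Otimes>\<^sub>M N2) (\<lambda>\<omega>. (X \<omega>, Y \<omega>)) = distr M N1 X \<Otimes>\<^sub>M distr M N2 Y"
    using assms(1) unfolding indep_var_distribution_eq by auto
  note [measurable] = assms(2,3)
  interpret D: prob_space "distr M N2 Y" by (rule prob_space_distr) simp
  have "(\<integral>\<^sup>+ \<omega>. f (X \<omega>) * g (Y \<omega>) \<partial>M)
      = (\<integral>\<^sup>+ z. f (fst z) * g (snd z) \<partial>distr M (N1 \<Otimes>\<^sub>M N2) (\<lambda>\<omega>. (X \<omega>, Y \<omega>)))"
    by (subst nn_integral_distr) auto
  also have "\<dots> = (\<integral>\<^sup>+ x. \<integral>\<^sup>+ y. f x * g y \<partial>distr M N2 Y \<partial>distr M N1 X)"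
    unfolding eq by (subst D.nn_integral_fst[symmetric]) auto
  also have "\<dots> = (\<integral>\<^sup>+ x. f x * (\<integral>\<^sup>+ y. g y \<partial>distr M N2 Y) \<partial>distr M N1 X)"
    by (simp add: nn_integral_cmult)
  also have "\<dots> = (\<integral>\<^sup>+ x. f x \<partial>distr M N1 X) * (\<integral>\<^sup>+ y. g y \<partial>distr M N2 Y)"
    by (rule nn_integral_multc) simp
  also have "\<dots> = (\<integral>\<^sup>+ \<omega>. f (X \<omega>) \<partial>M) * (\<integral>\<^sup>+ \<omega>. g (Y \<omega>) \<partial>M)"
    by (simp add: nn_integral_distr)
  finally show ?thesis .
qed

lemma indep_processes_nn_integral:
  assumes "indep_processes X Y" "0 \<le> s" "0 \<le> t" "f \<in> borel_measurable borel" "g \<in> borel_measurable borel"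
  shows "(\<integral>\<^sup>+ \<omega>. f (X s \<omega>) * g (Y t \<omega>) \<partial>M) = (\<integral>\<^sup>+ \<omega>. f (X s \<omega>) \<partial>M) * (\<integral>\<^sup>+ \<omega>. g (Y t \<omega>) \<partial>M)"
  using indep_var_nn_integral_mult[OF assms(1)[unfolded indep_processes_def]
      path_eval[OF assms(2,4)] path_eval[OF assms(3,5)]] assms(2,3)
  by (simp add: path_def)

lemma indep_pairs_nn_integral:
  assumes "indep_process_pairs X X' Y Y'" "indep_processes X X'" "indep_processes Y Y'"
    and "0 \<le> s" "0 \<le> s'" "0 \<le> t" "0 \<le> t'"
    and [measurable]: "f \<in> borel_measurable borel" "f' \<in> borel_measurable borel"
      "g \<in> borel_measurable borel" "g' \<in> borel_measurable borel"
  shows "(\<integral>\<^sup>+ \<omega>. (f (X s \<omega>) * f' (X' s' \<omega>)) * (g (Y t \<omega>) * g' (Y' t' \<omega>)) \<partial>M)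
    = ((\<integral>\<^sup>+ \<omega>. f (X s \<omega>) \<partial>M) * (\<integral>\<^sup>+ \<omega>. f' (X' s' \<omega>) \<partial>M))
      * ((\<integral>\<^sup>+ \<omega>. g (Y t \<omega>) \<partial>M) * (\<integral>\<^sup>+ \<omega>. g' (Y' t' \<omega>) \<partial>M))"
proof -
  have eval: "(\<lambda>q. h (fst q u) * h' (snd q u')) \<in> borel_measurable (path_space \<Otimes>\<^sub>M path_space)"
    if "0 \<le> u" "0 \<le> u'" "h \<in> borel_measurable borel" "h' \<in> borel_measurable borel"
    for h h' :: "real \<Rightarrow> ennreal" and u u'
    by (intro borel_measurable_times_ennreal measurable_compose[OF measurable_fst path_eval]
        measurable_compose[OF measurable_snd path_eval] that)
  show ?thesis
    using indep_var_nn_integral_mult[OF assms(1)[unfolded indep_process_pairs_def]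
        eval[OF assms(4,5,8,9)] eval[OF assms(6,7,10,11)]] assms(4-7)
      indep_processes_nn_integral[OF assms(2,4,5,8,9)] indep_processes_nn_integral[OF assms(3,6,7,10,11)]
    by (simp add: path_def)
qed

text \<open>The value at time \<open>n\<close> is almost surely the sum of the \<open>n\<close> increments over unit intervals, which
  are independent and distributed like \<open>X 1\<close>.\<close>

lemma levy_process_mgf_nat:
  assumes "levy_process X"
  shows "(\<integral>\<^sup>+ \<omega>. ennreal (exp (\<theta> * X (real n) \<omega>)) \<partial>M) = (\<integral>\<^sup>+ \<omega>. ennreal (exp (\<theta> * X 1 \<omega>)) \<partial>M) ^ n"
proof -
  have [measurable]: "X t \<in> borel_measurable M" if "0 \<le> t" for t
    using assms that unfolding levy_process_def by blast
  define D where "D i \<omega> = X (real (Suc i)) \<omega> - X (real i) \<omega>" for i \<omega>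
  have [measurable]: "D i \<in> borel_measurable M" for i unfolding D_def by measurable
  have "\<forall>n (t :: nat \<Rightarrow> real). 0 \<le> t 0 \<longrightarrow> (\<forall>i<n. t i < t (Suc i)) \<longrightarrow>
      indep_vars (\<lambda>_. borel) (\<lambda>i \<omega>. X (t (Suc i)) \<omega> - X (t i) \<omega>) {..<n}"
    using assms unfolding levy_process_def by blast
  from this[rule_format, of real n] have "indep_vars (\<lambda>_. borel) D {..<n}"
    by (simp add: D_def[abs_def])
  then have ind: "indep_vars (\<lambda>_. borel) (\<lambda>i \<omega>. ennreal (exp (\<theta> * D i \<omega>))) {..<n}"
    by (rule indep_vars_compose2) simp
  have step: "(\<integral>\<^sup>+ \<omega>. ennreal (exp (\<theta> * D i \<omega>)) \<partial>M) = (\<integral>\<^sup>+ \<omega>. ennreal (exp (\<theta> * X 1 \<omega>)) \<partial>M)" for i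
  proof -
    have "distr M borel (\<lambda>\<omega>. X (real i + 1) \<omega> - X (real i) \<omega>) = distr M borel (X 1)"
      using assms unfolding levy_process_def by simp
    then have eq: "distr M borel (D i) = distr M borel (X 1)" by (simp add: D_def[abs_def] add.commute)
    have "(\<integral>\<^sup>+ \<omega>. ennreal (exp (\<theta> * D i \<omega>)) \<partial>M) = (\<integral>\<^sup>+ x. ennreal (exp (\<theta> * x)) \<partial>distr M borel (D i))"
      by (simp add: nn_integral_distr)
    also have "\<dots> = (\<integral>\<^sup>+ \<omega>. ennreal (exp (\<theta> * X 1 \<omega>)) \<partial>M)"
      unfolding eq by (simp add: nn_integral_distr)
    finally show ?thesis .
  qed
  have "AE \<omega> in M. X 0 \<omega> = 0" using assms unfolding levy_process_def by blast
  then have "AE \<omega> in M. ennreal (exp (\<theta> * X (real n) \<omega>)) = (\<Prod>i<n. ennreal (exp (\<theta> * D i \<omega>)))"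
  proof eventually_elim
    case (elim \<omega>)
    have "(\<Sum>i<n. D i \<omega>) = X (real n) \<omega>"
      using elim sum_lessThan_telescope[of "\<lambda>i. X (real i) \<omega>" n] by (simp add: D_def)
    then have "exp (\<theta> * X (real n) \<omega>) = (\<Prod>i<n. exp (\<theta> * D i \<omega>))"
      by (simp add: exp_sum[symmetric] sum_distrib_left[symmetric])
    then show ?case by (simp add: prod_ennreal)
  qed
  then have "(\<integral>\<^sup>+ \<omega>. ennreal (exp (\<theta> * X (real n) \<omega>)) \<partial>M) = (\<integral>\<^sup>+ \<omega>. (\<Prod>i<n. ennreal (exp (\<theta> * D i \<omega>))) \<partial>M)"
    by (rule nn_integral_cong_AE)
  also have "\<dots> = (\<Prod>i<n. \<integral>\<^sup>+ \<omega>. ennreal (exp (\<theta> * D i \<omega>)) \<partial>M)"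
    using ind by (intro indep_vars_nn_integral) auto
  finally show ?thesis by (simp add: step)
qed

lemma subordinator_levy: "subordinator X \<Longrightarrow> levy_process X"
  by (simp add: subordinator_def)

lemma levy_process_measurable: "levy_process X \<Longrightarrow> 0 \<le> t \<Longrightarrow> X t \<in> borel_measurable M"
  by (simp add: levy_process_def)

lemma subordinator_AE:
  assumes "subordinator X"
  shows "AE \<omega> in M. X 0 \<omega> = 0 \<and> (\<forall>s\<ge>0. \<forall>t\<ge>s. X s \<omega> \<le> X t \<omega>)"
proof -
  have "AE \<omega> in M. X 0 \<omega> = 0" "AE \<omega> in M. mono_on {0..} (\<lambda>t. X t \<omega>)"
    using assms unfolding subordinator_def levy_process_def by auto
  then show ?thesis by eventually_elim (auto simp: monotone_on_def)
qed

lemma subordinator_AE_nonneg: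
  assumes "subordinator X" "0 \<le> t"
  shows "AE \<omega> in M. 0 \<le> X t \<omega>"
  using subordinator_AE[OF assms(1)] by eventually_elim (use assms(2) in force)

text \<open>With the clock rounded strictly upwards to a multiple of \<open>1 / (n + 1)\<close>, the time-changed variable
  is measurable because the clock takes countably many values. By right-continuity these variables
  converge almost surely to \<open>X (L \<omega>) \<omega>\<close> as \<open>n\<close> grows.\<close>

lemma time_change_measurable:
  assumes X: "levy_process X" and L: "L \<in> borel_measurable M" "AE \<omega> in M. 0 \<le> L \<omega>"
  shows "(\<lambda>\<omega>. X (L \<omega>) \<omega>) \<in> borel_measurable (completion M)"
proof -
  define N where "N n \<omega> = nat \<lfloor>real (Suc n) * L \<omega>\<rfloor>" for n \<omega>
  define T where "T n i = (real i + 1) / real (Suc n)" for n i :: nat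
  have N: "N n \<in> measurable M (count_space UNIV)" for n
    using L(1) unfolding N_def[abs_def] by measurable
  have XT: "X (T n i) \<in> borel_measurable M" for n i
    using levy_process_measurable[OF X] by (simp add: T_def)
  have "(\<lambda>\<omega>. X (T n (N n \<omega>)) \<omega>) \<in> borel_measurable M" for n
    using measurable_compose_countable[where f = "\<lambda>i. X (T n i)" and g = "N n", OF _ N] XT by blast
  then have "(\<lambda>\<omega>. lim (\<lambda>n. X (T n (N n \<omega>)) \<omega>)) \<in> borel_measurable M"
    by (rule borel_measurable_lim_metric)
  moreover have "AE \<omega> in M. X (L \<omega>) \<omega> = lim (\<lambda>n. X (T n (N n \<omega>)) \<omega>)"
  proof -
    have "AE \<omega> in M. cadlag (\<lambda>t. X t \<omega>)" using X unfolding levy_process_def by blast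
    with L(2) show ?thesis
    proof eventually_elim
      case (elim \<omega>)
      have bounds: "L \<omega> < T n (N n \<omega>)" "T n (N n \<omega>) \<le> L \<omega> + inverse (real (Suc n))" for n
      proof -
        have "0 \<le> \<lfloor>real (Suc n) * L \<omega>\<rfloor>" using elim(1) by simp
        then have "real (N n \<omega>) = of_int \<lfloor>real (Suc n) * L \<omega>\<rfloor>" unfolding N_def by simp
        then have "real (N n \<omega>) \<le> real (Suc n) * L \<omega>" "real (Suc n) * L \<omega> < real (N n \<omega>) + 1"
          by linarith+
        then show "L \<omega> < T n (N n \<omega>)" "T n (N n \<omega>) \<le> L \<omega> + inverse (real (Suc n))"
          by (simp_all add: T_def field_simps del: of_nat_Suc)
      qed
      have "(\<lambda>n. L \<omega> + inverse (real (Suc n))) \<longlonglongrightarrow> L \<omega> + 0"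
        by (intro tendsto_intros LIMSEQ_inverse_real_of_nat)
      then have "(\<lambda>n. L \<omega> + inverse (real (Suc n))) \<longlonglongrightarrow> L \<omega>" by simp
      then have "(\<lambda>n. T n (N n \<omega>)) \<longlonglongrightarrow> L \<omega>"
        by (rule tendsto_sandwich[rotated 3, where f = "\<lambda>_. L \<omega>"])
          (use bounds less_imp_le[OF bounds(1)] in simp_all)
      then have "filterlim (\<lambda>n. T n (N n \<omega>)) (at_right (L \<omega>)) sequentially"
        using bounds(1) by (simp add: filterlim_at less_imp_neq[symmetric])
      moreover have "((\<lambda>t. X t \<omega>) \<longlongrightarrow> X (L \<omega>) \<omega>) (at_right (L \<omega>))"
        using elim by (simp add: cadlag_def)
      ultimately have "(\<lambda>n. X (T n (N n \<omega>)) \<omega>) \<longlonglongrightarrow> X (L \<omega>) \<omega>"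
        by (rule filterlim_compose[rotated])
      then show ?case by (rule limI[symmetric])
    qed
  qed
  ultimately show ?thesis by (rule borel_measurable_completion_AE)
qed

end

lemma nn_integral_exp_pos:
  assumes "prob_space M" "X \<in> borel_measurable M"
  shows "(\<integral>\<^sup>+ \<omega>. ennreal (exp (\<theta> * X \<omega>)) \<partial>M) \<noteq> 0"
proof -
  interpret prob_space M by (rule assms(1))
  have [measurable]: "X \<in> borel_measurable M" by (rule assms(2))
  show ?thesis by (subst nn_integral_0_iff_AE) (auto simp: ennreal_eq_0_iff not_le AE_False)
qed

context prob_space
begin

lemma log_mgf_0: "log_mgf M X 0 = 0"
  by (simp add: log_mgf_def emeasure_space_1 ext_ln_def zero_ereal_def)

lemma log_mgf_mono:
  assumes "AE \<omega> in M. 0 \<le> X \<omega>" "a \<le> b"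
  shows "log_mgf M X a \<le> log_mgf M X b"
  unfolding log_mgf_def using assms
  by (intro ext_ln_mono nn_integral_mono_AE) (auto elim!: eventually_mono intro: mult_right_mono)

end

section \<open>The limit of the scaled cumulant generating functions\<close>

text \<open>Independence enters as a product formula for expectations, in a form that does not change when
  the indices \<open>1\<close> and \<open>2\<close> are exchanged. Negative \<open>\<theta>\<close> are thereby reduced to positive ones.\<close>

locale subordinated_pair = prob_space M
  for M :: "'a measure" +
  fixes S1 S2 L1 L2 :: "real \<Rightarrow> 'a \<Rightarrow> real"
  assumes subordinator1: "subordinator S1" and subordinator2: "subordinator S2"
    and clock1: "nonneg_process L1" and clock2: "nonneg_process L2"
    and factor: "\<lbrakk>0 \<le> s; 0 \<le> s'; 0 \<le> t; 0 \<le> t'; f \<in> borel_measurable borel; f' \<in> borel_measurable borel;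
      g \<in> borel_measurable borel; g' \<in> borel_measurable borel\<rbrakk> \<Longrightarrow>
      (\<integral>\<^sup>+ \<omega>. (f (L1 s \<omega>) * f' (L2 s' \<omega>)) * (g (S1 t \<omega>) * g' (S2 t' \<omega>)) \<partial>M)
      = ((\<integral>\<^sup>+ \<omega>. f (L1 s \<omega>) \<partial>M) * (\<integral>\<^sup>+ \<omega>. f' (L2 s' \<omega>) \<partial>M))
        * ((\<integral>\<^sup>+ \<omega>. g (S1 t \<omega>) \<partial>M) * (\<integral>\<^sup>+ \<omega>. g' (S2 t' \<omega>) \<partial>M))"
begin

lemma swapped: "subordinated_pair M S2 S1 L2 L1"
proof
  fix s s' t t' :: real and f f' g g' :: "real \<Rightarrow> ennreal"
  assume *: "0 \<le> s" "0 \<le> s'" "0 \<le> t" "0 \<le> t'" "f \<in> borel_measurable borel" "f' \<in> borel_measurable borel"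
    "g \<in> borel_measurable borel" "g' \<in> borel_measurable borel"
  show "(\<integral>\<^sup>+ \<omega>. (f (L2 s \<omega>) * f' (L1 s' \<omega>)) * (g (S2 t \<omega>) * g' (S1 t' \<omega>)) \<partial>M)
      = ((\<integral>\<^sup>+ \<omega>. f (L2 s \<omega>) \<partial>M) * (\<integral>\<^sup>+ \<omega>. f' (L1 s' \<omega>) \<partial>M))
        * ((\<integral>\<^sup>+ \<omega>. g (S2 t \<omega>) \<partial>M) * (\<integral>\<^sup>+ \<omega>. g' (S1 t' \<omega>) \<partial>M))"
    using factor[OF *(2,1,4,3,6,5,8,7)] by (simp add: mult.commute)
qed (use subordinator1 subordinator2 clock1 clock2 in auto)

lemma measurable_S: "0 \<le> t \<Longrightarrow> S1 t \<in> borel_measurable M" "0 \<le> t \<Longrightarrow> S2 t \<in> borel_measurable M"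
  using subordinator1 subordinator2 levy_process_measurable subordinator_levy by auto

lemma measurable_L: "0 \<le> t \<Longrightarrow> L1 t \<in> borel_measurable M" "0 \<le> t \<Longrightarrow> L2 t \<in> borel_measurable M"
  using clock1 clock2 by (auto simp: nonneg_process_def)

abbreviation mgf1 :: "real \<Rightarrow> ennreal" where
  "mgf1 \<theta> \<equiv> \<integral>\<^sup>+ \<omega>. ennreal (exp (\<theta> * S1 1 \<omega>)) \<partial>M"

abbreviation mgf2 :: "real \<Rightarrow> ennreal" where
  "mgf2 \<theta> \<equiv> \<integral>\<^sup>+ \<omega>. ennreal (exp (\<theta> * S2 1 \<omega>)) \<partial>M"

text \<open>Conditioning on the values \<open>i\<close> and \<open>j\<close> of the integer clocks turns the two exponential moments into
  the powers \<open>mgf1 \<theta>1 ^ (i + a)\<close> and \<open>mgf2 \<theta>2 ^ (j + b)\<close>. The offsets \<open>a\<close> and \<open>b\<close> allow rounding down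
  as well as up.\<close>

lemma mgf_integer_clocks:
  assumes "0 \<le> t"
  defines "N1 \<equiv> \<lambda>\<omega>. nat \<lfloor>L1 t \<omega>\<rfloor>" and "N2 \<equiv> \<lambda>\<omega>. nat \<lfloor>L2 t \<omega>\<rfloor>"
  shows "(\<integral>\<^sup>+ \<omega>. ennreal (exp (\<theta>1 * S1 (real (N1 \<omega> + a)) \<omega>)) * ennreal (exp (\<theta>2 * S2 (real (N2 \<omega> + b)) \<omega>)) \<partial>M)
    = (\<integral>\<^sup>+ \<omega>. mgf1 \<theta>1 ^ (N1 \<omega> + a) \<partial>M) * (\<integral>\<^sup>+ \<omega>. mgf2 \<theta>2 ^ (N2 \<omega> + b) \<partial>M)"
proof -
  define A where "A i \<omega> = ennreal (exp (\<theta>1 * S1 (real (i + a)) \<omega>))" for i \<omega>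
  define B where "B j \<omega> = ennreal (exp (\<theta>2 * S2 (real (j + b)) \<omega>))" for j \<omega>
  define P1 where "P1 i = (\<integral>\<^sup>+ \<omega>. indicator {i} (N1 \<omega>) \<partial>M)" for i
  define P2 where "P2 j = (\<integral>\<^sup>+ \<omega>. indicator {j} (N2 \<omega>) \<partial>M)" for j
  have N1[measurable]: "N1 \<in> measurable M (count_space UNIV)"
    and N2[measurable]: "N2 \<in> measurable M (count_space UNIV)"
    using measurable_L[OF assms(1)] unfolding N1_def N2_def by measurable
  have A[measurable]: "A i \<in> borel_measurable M" for i
    using measurable_S(1) unfolding A_def[abs_def] by measurable
  have B[measurable]: "B j \<in> borel_measurable M" for j
    using measurable_S(2) unfolding B_def[abs_def] by measurable
  have ind1[measurable]: "(\<lambda>\<omega>. indicator {i} (N1 \<omega>) :: ennreal) \<in> borel_measurable M" for i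
    by (rule measurable_compose[OF N1]) simp
  have BN2[measurable]: "(\<lambda>\<omega>. B (N2 \<omega>) \<omega>) \<in> borel_measurable M"
    by (rule measurable_compose_countable[OF B N2])
  have clock: "(\<integral>\<^sup>+ \<omega>. c ^ (N \<omega> + m) \<partial>M) = (\<Sum>i. (\<integral>\<^sup>+ \<omega>. indicator {i} (N \<omega>) \<partial>M) * c ^ (i + m))"
    if N: "N \<in> measurable M (count_space UNIV)" for N :: "'a \<Rightarrow> nat" and c :: ennreal and m
  proof -
    have "(\<integral>\<^sup>+ \<omega>. c ^ (N \<omega> + m) \<partial>M) = (\<Sum>i. \<integral>\<^sup>+ \<omega>. indicator {i} (N \<omega>) * c ^ (i + m) \<partial>M)"
      by (rule nn_integral_nat_valued[where F = "\<lambda>i _. c ^ (i + m)", OF _ N]) simp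
    also have "\<dots> = (\<Sum>i. (\<integral>\<^sup>+ \<omega>. indicator {i} (N \<omega>) \<partial>M) * c ^ (i + m))"
      by (intro suminf_cong nn_integral_multc measurable_compose[OF N]) simp
    finally show ?thesis .
  qed
  have term_eq: "(\<integral>\<^sup>+ \<omega>. indicator {j} (N2 \<omega>) * (indicator {i} (N1 \<omega>) * (A i \<omega> * B j \<omega>)) \<partial>M)
      = (P1 i * mgf1 \<theta>1 ^ (i + a)) * (P2 j * mgf2 \<theta>2 ^ (j + b))" for i j
  proof -
    have "(\<integral>\<^sup>+ \<omega>. indicator {j} (N2 \<omega>) * (indicator {i} (N1 \<omega>) * (A i \<omega> * B j \<omega>)) \<partial>M)
        = (\<integral>\<^sup>+ \<omega>. (indicator {i} (N1 \<omega>) * indicator {j} (N2 \<omega>)) * (A i \<omega> * B j \<omega>) \<partial>M)"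
      by (simp add: mult_ac)
    also have "\<dots> = (P1 i * P2 j) * ((\<integral>\<^sup>+ \<omega>. A i \<omega> \<partial>M) * (\<integral>\<^sup>+ \<omega>. B j \<omega> \<partial>M))"
      unfolding A_def B_def P1_def P2_def N1_def N2_def
      by (rule factor[where f = "\<lambda>x. indicator {i} (nat \<lfloor>x\<rfloor>)" and f' = "\<lambda>x. indicator {j} (nat \<lfloor>x\<rfloor>)"
            and g = "\<lambda>x. ennreal (exp (\<theta>1 * x))" and g' = "\<lambda>x. ennreal (exp (\<theta>2 * x))"])
        (use assms(1) in \<open>auto intro!: measurable_compose[of "\<lambda>x::real. nat \<lfloor>x\<rfloor>" borel "count_space UNIV"]\<close>)
    also have "\<dots> = (P1 i * P2 j) * (mgf1 \<theta>1 ^ (i + a) * mgf2 \<theta>2 ^ (j + b))"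
      using levy_process_mgf_nat[OF subordinator_levy[OF subordinator1]]
        levy_process_mgf_nat[OF subordinator_levy[OF subordinator2]]
      by (simp only: A_def B_def)
    finally show ?thesis by (simp only: mult_ac)
  qed
  have "(\<integral>\<^sup>+ \<omega>. A (N1 \<omega>) \<omega> * B (N2 \<omega>) \<omega> \<partial>M)
      = (\<Sum>i. \<integral>\<^sup>+ \<omega>. indicator {i} (N1 \<omega>) * (A i \<omega> * B (N2 \<omega>) \<omega>) \<partial>M)"
    by (rule nn_integral_nat_valued[where F = "\<lambda>i \<omega>. A i \<omega> * B (N2 \<omega>) \<omega>"]) auto
  also have "\<dots> = (\<Sum>i. \<Sum>j. \<integral>\<^sup>+ \<omega>. indicator {j} (N2 \<omega>) * (indicator {i} (N1 \<omega>) * (A i \<omega> * B j \<omega>)) \<partial>M)"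
    by (intro suminf_cong nn_integral_nat_valued[where F = "\<lambda>j \<omega>. indicator {_} (N1 \<omega>) * (A _ \<omega> * B j \<omega>)"]) auto
  also have "\<dots> = (\<Sum>i. P1 i * mgf1 \<theta>1 ^ (i + a)) * (\<Sum>j. P2 j * mgf2 \<theta>2 ^ (j + b))"
    by (simp only: term_eq ennreal_suminf_cmult ennreal_suminf_multc)
  also have "(\<Sum>i. P1 i * mgf1 \<theta>1 ^ (i + a)) = (\<integral>\<^sup>+ \<omega>. mgf1 \<theta>1 ^ (N1 \<omega> + a) \<partial>M)"
    unfolding P1_def by (rule clock[OF N1, symmetric])
  also have "(\<Sum>j. P2 j * mgf2 \<theta>2 ^ (j + b)) = (\<integral>\<^sup>+ \<omega>. mgf2 \<theta>2 ^ (N2 \<omega> + b) \<partial>M)"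
    unfolding P2_def by (rule clock[OF N2, symmetric])
  finally show ?thesis by (simp add: A_def B_def)
qed

definition difference :: "real \<Rightarrow> 'a \<Rightarrow> real" where
  "difference t \<omega> = S1 (L1 t \<omega>) \<omega> - S2 (L2 t \<omega>) \<omega>"

lemma AE_bracket:
  assumes "0 \<le> t"
  shows "AE \<omega> in M. 0 \<le> L1 t \<omega> \<and> 0 \<le> L2 t \<omega> \<and> 0 \<le> S2 (real (nat \<lfloor>L2 t \<omega>\<rfloor>)) \<omega> \<and>
    S1 (real (nat \<lfloor>L1 t \<omega>\<rfloor>)) \<omega> \<le> S1 (L1 t \<omega>) \<omega> \<and> S1 (L1 t \<omega>) \<omega> \<le> S1 (real (nat \<lfloor>L1 t \<omega>\<rfloor> + 1)) \<omega> \<and>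
    S2 (real (nat \<lfloor>L2 t \<omega>\<rfloor>)) \<omega> \<le> S2 (L2 t \<omega>) \<omega> \<and> S2 (L2 t \<omega>) \<omega> \<le> S2 (real (nat \<lfloor>L2 t \<omega>\<rfloor> + 1)) \<omega>"
proof -
  have "AE \<omega> in M. 0 \<le> L1 t \<omega>" "AE \<omega> in M. 0 \<le> L2 t \<omega>"
    using clock1 clock2 assms by (auto simp: nonneg_process_def)
  with subordinator_AE[OF subordinator1] subordinator_AE[OF subordinator2] show ?thesis
  proof eventually_elim
    case (elim \<omega>)
    have bracket: "0 \<le> real (nat \<lfloor>x\<rfloor>) \<and> real (nat \<lfloor>x\<rfloor>) \<le> x \<and> x \<le> real (nat \<lfloor>x\<rfloor> + 1)"
      if "0 \<le> x" for x :: real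
      using that by linarith
    define a a' where "a = real (nat \<lfloor>L1 t \<omega>\<rfloor>)" and "a' = real (nat \<lfloor>L1 t \<omega>\<rfloor> + 1)"
    define b b' where "b = real (nat \<lfloor>L2 t \<omega>\<rfloor>)" and "b' = real (nat \<lfloor>L2 t \<omega>\<rfloor> + 1)"
    note fold = a_def[symmetric] a'_def[symmetric] b_def[symmetric] b'_def[symmetric]
    have a: "0 \<le> a" "a \<le> L1 t \<omega>" "L1 t \<omega> \<le> a'" and b: "0 \<le> b" "b \<le> L2 t \<omega>" "L2 t \<omega> \<le> b'"
      using bracket[OF elim(3)] bracket[OF elim(4)] unfolding fold by auto
    have "S2 0 \<omega> \<le> S2 b \<omega>" using elim(2) b(1) by blast
    then show ?case unfolding fold using elim a b by auto
  qed
qed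

text \<open>The difference grows if \<open>L1\<close> is rounded up and \<open>S2\<close> is dropped; rounding up costs one factor
  \<open>exp \<kappa>\<close>.\<close>

lemma mgf_difference_le:
  assumes "0 \<le> t" "0 \<le> \<theta>" "mgf1 \<theta> = ennreal (exp \<kappa>)" "0 \<le> \<kappa>"
  shows "(\<integral>\<^sup>+ \<omega>. ennreal (exp (\<theta> * difference t \<omega>)) \<partial>M)
    \<le> ennreal (exp \<kappa>) * (\<integral>\<^sup>+ \<omega>. ennreal (exp (\<kappa> * L1 t \<omega>)) \<partial>M)"
proof -
  have [measurable]: "L1 t \<in> borel_measurable M" using measurable_L assms by simp
  have "(\<integral>\<^sup>+ \<omega>. ennreal (exp (\<theta> * difference t \<omega>)) \<partial>M)
    \<le> (\<integral>\<^sup>+ \<omega>. ennreal (exp (\<theta> * S1 (real (nat \<lfloor>L1 t \<omega>\<rfloor> + 1)) \<omega>))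
        * ennreal (exp (0 * S2 (real (nat \<lfloor>L2 t \<omega>\<rfloor> + 0)) \<omega>)) \<partial>M)"
    \<comment> \<open>the second factor is \<open>1\<close>; it brings the integral into the form of \<open>mgf_integer_clocks\<close>\<close>
  proof (rule nn_integral_mono_AE)
    show "AE \<omega> in M. ennreal (exp (\<theta> * difference t \<omega>))
      \<le> ennreal (exp (\<theta> * S1 (real (nat \<lfloor>L1 t \<omega>\<rfloor> + 1)) \<omega>))
        * ennreal (exp (0 * S2 (real (nat \<lfloor>L2 t \<omega>\<rfloor> + 0)) \<omega>))"
      using AE_bracket[OF assms(1)]
    proof eventually_elim
      case (elim \<omega>)
      then have "\<theta> * difference t \<omega> \<le> \<theta> * S1 (real (nat \<lfloor>L1 t \<omega>\<rfloor> + 1)) \<omega>"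
        unfolding difference_def using assms(2) by (intro mult_left_mono) auto
      then show ?case by (simp add: ennreal_leI)
    qed
  qed
  also have "\<dots> = (\<integral>\<^sup>+ \<omega>. ennreal (exp \<kappa>) ^ (nat \<lfloor>L1 t \<omega>\<rfloor> + 1) \<partial>M)"
    unfolding mgf_integer_clocks[OF assms(1)] assms(3) by (simp add: emeasure_space_1)
  also have "\<dots> \<le> (\<integral>\<^sup>+ \<omega>. ennreal (exp \<kappa>) * ennreal (exp (\<kappa> * L1 t \<omega>)) \<partial>M)"
  proof (rule nn_integral_mono_AE)
    show "AE \<omega> in M. ennreal (exp \<kappa>) ^ (nat \<lfloor>L1 t \<omega>\<rfloor> + 1) \<le> ennreal (exp \<kappa>) * ennreal (exp (\<kappa> * L1 t \<omega>))"
      using AE_bracket[OF assms(1)]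
    proof eventually_elim
      case (elim \<omega>)
      define n where "n = nat \<lfloor>L1 t \<omega>\<rfloor>"
      have "real n \<le> L1 t \<omega>" using elim unfolding n_def by linarith
      then have "\<kappa> * real n \<le> \<kappa> * L1 t \<omega>" using assms(4) by (rule mult_left_mono)
      then have "exp \<kappa> ^ (n + 1) \<le> exp \<kappa> * exp (\<kappa> * L1 t \<omega>)"
        by (simp add: exp_of_nat2_mult[symmetric])
      from ennreal_leI[OF this] show ?case
        unfolding n_def[symmetric] by (simp add: ennreal_power[symmetric] ennreal_mult)
    qed
  qed
  finally show ?thesis by (simp add: nn_integral_cmult)
qed

text \<open>The difference shrinks if \<open>L1\<close> is rounded down and \<open>L2\<close> is rounded up. The moments of the
  integer clocks differ from those of \<open>L1\<close> and \<open>L2\<close> by at most one factor \<open>exp \<kappa>\<close> and \<open>exp \<mu>\<close>,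
  respectively.\<close>

lemma mgf_difference_ge:
  assumes "0 \<le> t" "0 \<le> \<theta>" "mgf1 \<theta> = ennreal (exp \<kappa>)" "0 \<le> \<kappa>" "mgf2 (- \<theta>) = ennreal (exp \<mu>)" "\<mu> \<le> 0"
  shows "ennreal (exp (\<mu> - \<kappa>)) * ((\<integral>\<^sup>+ \<omega>. ennreal (exp (\<kappa> * L1 t \<omega>)) \<partial>M) * (\<integral>\<^sup>+ \<omega>. ennreal (exp (\<mu> * L2 t \<omega>)) \<partial>M))
    \<le> (\<integral>\<^sup>+ \<omega>. ennreal (exp (\<theta> * difference t \<omega>)) \<partial>M)"
proof -
  have [measurable]: "L1 t \<in> borel_measurable M" "L2 t \<in> borel_measurable M" using measurable_L assms by auto
  have 1: "ennreal (exp (- \<kappa>)) * (\<integral>\<^sup>+ \<omega>. ennreal (exp (\<kappa> * L1 t \<omega>)) \<partial>M)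
      \<le> (\<integral>\<^sup>+ \<omega>. ennreal (exp \<kappa>) ^ (nat \<lfloor>L1 t \<omega>\<rfloor> + 0) \<partial>M)"
  proof (subst nn_integral_cmult[symmetric], simp, rule nn_integral_mono_AE)
    show "AE \<omega> in M. ennreal (exp (- \<kappa>)) * ennreal (exp (\<kappa> * L1 t \<omega>)) \<le> ennreal (exp \<kappa>) ^ (nat \<lfloor>L1 t \<omega>\<rfloor> + 0)"
      using AE_bracket[OF assms(1)]
    proof eventually_elim
      case (elim \<omega>)
      then have "L1 t \<omega> \<le> real (nat \<lfloor>L1 t \<omega>\<rfloor>) + 1" by linarith
      then have "\<kappa> * L1 t \<omega> \<le> \<kappa> * (real (nat \<lfloor>L1 t \<omega>\<rfloor>) + 1)" using assms(4) by (rule mult_left_mono)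
      then have "exp (- \<kappa>) * exp (\<kappa> * L1 t \<omega>) \<le> exp \<kappa> ^ nat \<lfloor>L1 t \<omega>\<rfloor>"
        by (simp add: exp_of_nat_mult[symmetric] exp_add[symmetric] algebra_simps del: exp_of_nat_mult)
      from ennreal_leI[OF this] show ?case by (simp add: ennreal_power[symmetric] ennreal_mult)
    qed
  qed
  have 2: "ennreal (exp \<mu>) * (\<integral>\<^sup>+ \<omega>. ennreal (exp (\<mu> * L2 t \<omega>)) \<partial>M)
      \<le> (\<integral>\<^sup>+ \<omega>. ennreal (exp \<mu>) ^ (nat \<lfloor>L2 t \<omega>\<rfloor> + 1) \<partial>M)"
  proof (subst nn_integral_cmult[symmetric], simp, rule nn_integral_mono_AE)
    show "AE \<omega> in M. ennreal (exp \<mu>) * ennreal (exp (\<mu> * L2 t \<omega>)) \<le> ennreal (exp \<mu>) ^ (nat \<lfloor>L2 t \<omega>\<rfloor> + 1)"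
      using AE_bracket[OF assms(1)]
    proof eventually_elim
      case (elim \<omega>)
      define n where "n = nat \<lfloor>L2 t \<omega>\<rfloor>"
      have "real n \<le> L2 t \<omega>" using elim unfolding n_def by linarith
      then have "\<mu> * L2 t \<omega> \<le> \<mu> * real n" using assms(6) by (rule mult_left_mono_neg)
      then have "exp \<mu> * exp (\<mu> * L2 t \<omega>) \<le> exp \<mu> ^ (n + 1)"
        by (simp add: exp_of_nat2_mult[symmetric])
      from ennreal_leI[OF this] show ?case
        unfolding n_def[symmetric] by (simp add: ennreal_power[symmetric] ennreal_mult)
    qed
  qed
  have "ennreal (exp (\<mu> - \<kappa>)) * ((\<integral>\<^sup>+ \<omega>. ennreal (exp (\<kappa> * L1 t \<omega>)) \<partial>M) * (\<integral>\<^sup>+ \<omega>. ennreal (exp (\<mu> * L2 t \<omega>)) \<partial>M))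
    = (ennreal (exp (- \<kappa>)) * (\<integral>\<^sup>+ \<omega>. ennreal (exp (\<kappa> * L1 t \<omega>)) \<partial>M))
      * (ennreal (exp \<mu>) * (\<integral>\<^sup>+ \<omega>. ennreal (exp (\<mu> * L2 t \<omega>)) \<partial>M))"
  proof -
    have "ennreal (exp (\<mu> - \<kappa>)) = ennreal (exp (- \<kappa>)) * ennreal (exp \<mu>)"
      by (simp add: ennreal_mult[symmetric] exp_add[symmetric])
    then show ?thesis by (simp only: mult_ac)
  qed
  also have "\<dots> \<le> (\<integral>\<^sup>+ \<omega>. ennreal (exp \<kappa>) ^ (nat \<lfloor>L1 t \<omega>\<rfloor> + 0) \<partial>M)
      * (\<integral>\<^sup>+ \<omega>. ennreal (exp \<mu>) ^ (nat \<lfloor>L2 t \<omega>\<rfloor> + 1) \<partial>M)"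
    using 1 2 by (rule mult_mono) auto
  also have "\<dots> = (\<integral>\<^sup>+ \<omega>. ennreal (exp (\<theta> * S1 (real (nat \<lfloor>L1 t \<omega>\<rfloor> + 0)) \<omega>))
        * ennreal (exp (- \<theta> * S2 (real (nat \<lfloor>L2 t \<omega>\<rfloor> + 1)) \<omega>)) \<partial>M)"
    unfolding mgf_integer_clocks[OF assms(1)] assms(3,5) ..
  also have "\<dots> \<le> (\<integral>\<^sup>+ \<omega>. ennreal (exp (\<theta> * difference t \<omega>)) \<partial>M)"
  proof (rule nn_integral_mono_AE)
    show "AE \<omega> in M. ennreal (exp (\<theta> * S1 (real (nat \<lfloor>L1 t \<omega>\<rfloor> + 0)) \<omega>))
        * ennreal (exp (- \<theta> * S2 (real (nat \<lfloor>L2 t \<omega>\<rfloor> + 1)) \<omega>)) \<le> ennreal (exp (\<theta> * difference t \<omega>))"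
      using AE_bracket[OF assms(1)]
    proof eventually_elim
      case (elim \<omega>)
      let ?d = "S1 (real (nat \<lfloor>L1 t \<omega>\<rfloor> + 0)) \<omega> - S2 (real (nat \<lfloor>L2 t \<omega>\<rfloor> + 1)) \<omega>"
      have "\<theta> * ?d \<le> \<theta> * difference t \<omega>"
        unfolding difference_def using assms(2) elim by (intro mult_left_mono) auto
      then have "ennreal (exp (\<theta> * ?d)) \<le> ennreal (exp (\<theta> * difference t \<omega>))" by (simp add: ennreal_leI)
      moreover have "exp (\<theta> * ?d) = exp (\<theta> * S1 (real (nat \<lfloor>L1 t \<omega>\<rfloor> + 0)) \<omega>)
          * exp (- \<theta> * S2 (real (nat \<lfloor>L2 t \<omega>\<rfloor> + 1)) \<omega>)"
        by (simp only: exp_add[symmetric]) (simp add: algebra_simps)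
      ultimately show ?case by (simp only: ennreal_mult exp_ge_zero)
    qed
  qed
  finally show ?thesis .
qed

lemmas AE_S1_nonneg = subordinator_AE_nonneg[OF subordinator1, OF zero_le_one]
lemmas AE_S2_nonneg = subordinator_AE_nonneg[OF subordinator2, OF zero_le_one]

text \<open>Up to constant factors, the moment generating function of the difference lies between that of
  \<open>L1\<close> at \<open>\<kappa>\<close> and its product with that of \<open>L2\<close> at \<open>\<mu>\<close>. As \<open>\<kappa> \<ge> 0 \<ge> \<mu>\<close>, these have the rates \<open>f1 \<kappa>\<close>
  and \<open>f1 \<kappa> + 0\<close>.\<close>

lemma log_mgf_difference_right:
  assumes \<theta>: "0 \<le> \<theta>" and \<kappa>: "log_mgf M (S1 1) \<theta> = ereal \<kappa>"
    and L: "log_mgf_limit M L1 f1" "log_mgf_limit M L2 f2"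
  shows "((\<lambda>t. log_mgf M (difference t) \<theta> / ereal t) \<longlongrightarrow> ereal (f1 \<kappa>)) at_top"
proof -
  have k: "mgf1 \<theta> = ennreal (exp \<kappa>)" using \<kappa> by (simp add: log_mgf_def ext_ln_eq_ereal)
  have \<kappa>0: "0 \<le> \<kappa>" using log_mgf_mono[OF AE_S1_nonneg \<theta>] by (simp add: log_mgf_0 \<kappa>)
  have "log_mgf M (S2 1) (- \<theta>) \<le> 0"
    using log_mgf_mono[OF AE_S2_nonneg, of "- \<theta>" 0] \<theta> by (simp add: log_mgf_0)
  moreover have "log_mgf M (S2 1) (- \<theta>) \<noteq> - \<infinity>"
    using nn_integral_exp_pos[OF prob_space_axioms measurable_S(2)[of 1], of "- \<theta>"]
    by (simp add: log_mgf_def ext_ln_def)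
  ultimately obtain \<mu> where \<mu>: "log_mgf M (S2 1) (- \<theta>) = ereal \<mu>" "\<mu> \<le> 0"
    by (cases "log_mgf M (S2 1) (- \<theta>)") auto
  then have l: "mgf2 (- \<theta>) = ennreal (exp \<mu>)" by (simp add: log_mgf_def ext_ln_eq_ereal)
  let ?m1 = "\<lambda>t. \<integral>\<^sup>+ \<omega>. ennreal (exp (\<kappa> * L1 t \<omega>)) \<partial>M" and ?m2 = "\<lambda>t. \<integral>\<^sup>+ \<omega>. ennreal (exp (\<mu> * L2 t \<omega>)) \<partial>M"
  have "((\<lambda>t. ext_ln (?m1 t) / ereal t) \<longlongrightarrow> ereal (f1 \<kappa>)) at_top"
    using L(1)[unfolded log_mgf_limit_def, rule_format, of \<kappa>] \<kappa>0 by (simp add: log_mgf_def)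
  then have m1: "\<forall>\<^sub>F t in at_top. ennreal (exp ((f1 \<kappa> - e) * t)) \<le> ?m1 t \<and> ?m1 t \<le> ennreal (exp ((f1 \<kappa> + e) * t))"
    if "0 < e" for e
    using that unfolding tendsto_ext_ln_div_iff by blast
  have "((\<lambda>t. ext_ln (?m2 t) / ereal t) \<longlongrightarrow> ereal 0) at_top"
  proof (cases "\<mu> = 0")
    case True
    \<comment> \<open>at the argument \<open>0\<close> the integral equals \<open>1\<close>, so its rate is \<open>0\<close> whatever the value of \<open>f2 0\<close>\<close>
    have "((\<lambda>t. 0 / ereal t) \<longlongrightarrow> ereal 0) at_top"
      by (simp add: zero_ereal_def[symmetric])
    then show ?thesis using True by (simp add: emeasure_space_1 ext_ln_def zero_ereal_def[symmetric])
  next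
    case False
    then show ?thesis
      using L(2)[unfolded log_mgf_limit_def, rule_format, of \<mu>] \<mu>(2) by (simp add: log_mgf_def)
  qed
  then have m2: "\<forall>\<^sub>F t in at_top. ennreal (exp ((0 - e) * t)) \<le> ?m2 t \<and> ?m2 t \<le> ennreal (exp ((0 + e) * t))"
    if "0 < e" for e
    using that unfolding tendsto_ext_ln_div_iff by blast
  show ?thesis unfolding log_mgf_def tendsto_ext_ln_div_iff
  proof (intro allI impI)
    fix e :: real assume "0 < e"
    \<comment> \<open>one third of the error for each clock and one for the constant factors\<close>
    define d where "d = e / 3"
    have d: "0 < d" "e = 3 * d" using \<open>0 < e\<close> by (simp_all add: d_def)
    have "\<forall>\<^sub>F t in at_top. exp (\<kappa> - \<mu>) \<le> exp (d * t)" using d(1) by (rule eventually_const_le_exp)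
    then show "\<forall>\<^sub>F t in at_top. ennreal (exp ((f1 \<kappa> - e) * t))
        \<le> (\<integral>\<^sup>+ \<omega>. ennreal (exp (\<theta> * difference t \<omega>)) \<partial>M) \<and>
      (\<integral>\<^sup>+ \<omega>. ennreal (exp (\<theta> * difference t \<omega>)) \<partial>M) \<le> ennreal (exp ((f1 \<kappa> + e) * t))"
      using m1[OF d(1)] m2[OF d(1)] eventually_ge_at_top[of 0]
    proof eventually_elim
      case (elim t)
      have dt: "0 \<le> d * t" "\<kappa> - \<mu> \<le> d * t" using elim d by auto
      have "ennreal (exp ((f1 \<kappa> - e) * t))
          \<le> ennreal (exp (\<mu> - \<kappa>)) * (ennreal (exp ((f1 \<kappa> - d) * t)) * ennreal (exp ((0 - d) * t)))"
      proof -
        have "(f1 \<kappa> - e) * t \<le> (\<mu> - \<kappa>) + ((f1 \<kappa> - d) * t + (0 - d) * t)"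
          using dt unfolding d(2) by (simp add: algebra_simps)
        then have "exp ((f1 \<kappa> - e) * t) \<le> exp (\<mu> - \<kappa>) * (exp ((f1 \<kappa> - d) * t) * exp ((0 - d) * t))"
          unfolding exp_add[symmetric] by (simp only: exp_le_cancel_iff)
        from ennreal_leI[OF this] show ?thesis
          by (simp only: ennreal_mult exp_ge_zero mult_nonneg_nonneg)
      qed
      also have "\<dots> \<le> ennreal (exp (\<mu> - \<kappa>)) * (?m1 t * ?m2 t)"
        using elim by (intro mult_left_mono mult_mono) auto
      also have "\<dots> \<le> (\<integral>\<^sup>+ \<omega>. ennreal (exp (\<theta> * difference t \<omega>)) \<partial>M)"
        using elim \<theta> k \<kappa>0 l \<mu>(2) by (intro mgf_difference_ge) auto
      finally have lower: "ennreal (exp ((f1 \<kappa> - e) * t)) \<le> (\<integral>\<^sup>+ \<omega>. ennreal (exp (\<theta> * difference t \<omega>)) \<partial>M)" .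
      have "(\<integral>\<^sup>+ \<omega>. ennreal (exp (\<theta> * difference t \<omega>)) \<partial>M) \<le> ennreal (exp \<kappa>) * ?m1 t"
        using elim \<theta> k \<kappa>0 by (intro mgf_difference_le) auto
      also have "\<dots> \<le> ennreal (exp \<kappa>) * ennreal (exp ((f1 \<kappa> + d) * t))"
        using elim by (intro mult_left_mono) auto
      also have "\<dots> \<le> ennreal (exp ((f1 \<kappa> + e) * t))"
      proof -
        have "\<kappa> + (f1 \<kappa> + d) * t \<le> (f1 \<kappa> + e) * t"
          using dt \<mu>(2) unfolding d(2) by (simp add: algebra_simps)
        then have "exp \<kappa> * exp ((f1 \<kappa> + d) * t) \<le> exp ((f1 \<kappa> + e) * t)"
          unfolding exp_add[symmetric] by (simp only: exp_le_cancel_iff)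
        from ennreal_leI[OF this] show ?thesis
          by (simp only: ennreal_mult exp_ge_zero)
      qed
      finally show ?case using lower by blast
    qed
  qed
qed

lemma measurable_difference:
  assumes "0 \<le> t"
  shows "difference t \<in> borel_measurable (completion M)"
proof -
  have "AE \<omega> in M. 0 \<le> L1 t \<omega>" "AE \<omega> in M. 0 \<le> L2 t \<omega>"
    using clock1 clock2 assms by (auto simp: nonneg_process_def)
  then have "(\<lambda>\<omega>. S1 (L1 t \<omega>) \<omega>) \<in> borel_measurable (completion M)"
    and "(\<lambda>\<omega>. S2 (L2 t \<omega>) \<omega>) \<in> borel_measurable (completion M)"
    using measurable_L[OF assms] subordinator_levy subordinator1 subordinator2
    by (simp_all add: time_change_measurable)
  then show ?thesis unfolding difference_def[abs_def] by (rule borel_measurable_diff)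
qed

end

section \<open>The large deviation principle\<close>

lemma ext_inf_mono:
  assumes "admissible f" "0 \<le> a" "a \<le> b"
  shows "ext_inf f a \<le> ext_inf f b"
proof (cases "b = \<infinity>")
  case False
  then obtain x y where "a = ereal x" "b = ereal y" "0 \<le> x" "x \<le> y"
    using assms(2,3) by (cases a; cases b) auto
  then show ?thesis using assms(1) by (auto simp: ext_inf_def admissible_def monotone_on_def)
qed (simp add: ext_inf_def)

lemma Psi_minus:
  assumes "admissible f1" "admissible f2" "\<kappa>1 0 = 0" "\<kappa>2 0 = 0" "0 \<le> \<theta>"
  shows "Psi f1 f2 \<kappa>1 \<kappa>2 (- \<theta>) = ext_inf f2 (\<kappa>2 \<theta>)"
  using assms by (cases "\<theta> = 0") (auto simp: Psi_def ext_inf_def admissible_def)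

context subordinated_pair
begin

abbreviation Psi_limit :: "(real \<Rightarrow> real) \<Rightarrow> (real \<Rightarrow> real) \<Rightarrow> real \<Rightarrow> ereal" where
  "Psi_limit f1 f2 \<equiv> Psi f1 f2 (log_mgf M (S1 1)) (log_mgf M (S2 1))"

lemma log_mgf_difference:
  assumes f: "admissible f1" "admissible f2"
    and L: "log_mgf_limit M L1 f1" "log_mgf_limit M L2 f2" and fin: "Psi_limit f1 f2 \<theta> < \<infinity>"
  shows "((\<lambda>t. log_mgf M (difference t) \<theta> / ereal t) \<longlongrightarrow> Psi_limit f1 f2 \<theta>) at_top"
proof (cases "0 \<le> \<theta>")
  case True
  have "0 \<le> log_mgf M (S1 1) \<theta>" using log_mgf_mono[OF AE_S1_nonneg True] by (simp add: log_mgf_0)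
  moreover have "log_mgf M (S1 1) \<theta> \<noteq> \<infinity>" using fin True by (auto simp: Psi_def ext_inf_def)
  ultimately obtain \<kappa> where \<kappa>: "log_mgf M (S1 1) \<theta> = ereal \<kappa>" by (cases "log_mgf M (S1 1) \<theta>") auto
  show ?thesis using log_mgf_difference_right[OF True \<kappa> L] True \<kappa> by (simp add: Psi_def ext_inf_def)
next
  case False
  interpret R: subordinated_pair M S2 S1 L2 L1 by (rule swapped)
  have neg: "0 \<le> - \<theta>" using False by simp
  have "0 \<le> log_mgf M (S2 1) (- \<theta>)" using log_mgf_mono[OF AE_S2_nonneg neg] by (simp add: log_mgf_0)
  moreover have "log_mgf M (S2 1) (- \<theta>) \<noteq> \<infinity>" using fin False by (auto simp: Psi_def ext_inf_def)
  ultimately obtain \<kappa> where \<kappa>: "log_mgf M (S2 1) (- \<theta>) = ereal \<kappa>" by (cases "log_mgf M (S2 1) (- \<theta>)") auto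
  have "- \<theta> * R.difference t \<omega> = \<theta> * difference t \<omega>" for t \<omega>
    by (simp add: R.difference_def difference_def algebra_simps)
  then show ?thesis using R.log_mgf_difference_right[OF neg \<kappa> L(2,1)] False \<kappa>
    by (simp add: Psi_def ext_inf_def log_mgf_def)
qed

text \<open>The functions \<open>\<kappa>i\<close> are nonnegative and nondecreasing on \<open>[0,\<infinity>)\<close> because subordinators take
  nonnegative values. Composition with the nondecreasing \<open>fi\<close> preserves this, and each half of
  \<open>\<Psi>\<close> starts from \<open>fi 0 = 0\<close>.\<close>

lemma unimodal_Psi:
  assumes f: "admissible f1" "admissible f2" and smooth: "essentially_smooth (Psi_limit f1 f2)"
    and fin: "0 < \<delta>" "log_mgf M (S1 1) \<delta> < \<infinity>" "log_mgf M (S2 1) \<delta> < \<infinity>"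
  shows "unimodal_cgf (Psi_limit f1 f2)"
proof
  note minus = Psi_minus[OF f, where ?\<kappa>1.0 = "log_mgf M (S1 1)" and ?\<kappa>2.0 = "log_mgf M (S2 1)", OF log_mgf_0 log_mgf_0]
  have nonneg: "0 \<le> log_mgf M (S1 1) a" "0 \<le> log_mgf M (S2 1) a" if "0 \<le> a" for a
    using log_mgf_mono[OF AE_S1_nonneg that] log_mgf_mono[OF AE_S2_nonneg that] by (simp_all add: log_mgf_0)
  show "Psi_limit f1 f2 0 = 0" using f by (simp add: Psi_def log_mgf_0 ext_inf_def admissible_def)
  show "Psi_limit f1 f2 a \<le> Psi_limit f1 f2 b" if "0 \<le> a" "a \<le> b" for a b
    using that nonneg ext_inf_mono[OF f(1)] log_mgf_mono[OF AE_S1_nonneg] by (simp add: Psi_def)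
  show "Psi_limit f1 f2 (- a) \<le> Psi_limit f1 f2 (- b)" if "0 \<le> a" "a \<le> b" for a b
    using that nonneg ext_inf_mono[OF f(2)] log_mgf_mono[OF AE_S2_nonneg] by (simp add: minus)
  show "\<exists>\<delta>>0. Psi_limit f1 f2 \<delta> < \<infinity> \<and> Psi_limit f1 f2 (- \<delta>) < \<infinity>"
  proof (intro exI conjI)
    show "Psi_limit f1 f2 \<delta> < \<infinity>" using fin by (simp add: Psi_def ext_inf_def)
    show "Psi_limit f1 f2 (- \<delta>) < \<infinity>" using fin by (simp add: Psi_def ext_inf_def)
  qed (rule fin(1))
qed (rule smooth)

end

theorem proposition5p2:
  fixes N :: "'b measure" and S :: "real \<Rightarrow> 'b \<Rightarrow> real"
    and M :: "'a measure" and S1 S2 L1 L2 :: "real \<Rightarrow> 'a \<Rightarrow> real"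
    and f1 f2 :: "real \<Rightarrow> real"
  defines "\<kappa>1 \<equiv> log_mgf M (S1 1)" and "\<kappa>2 \<equiv> log_mgf M (S2 1)"
  assumes "prob_space N" and "prob_space M"
    and "prob_space.levy_process N S"
    and "eventually (\<lambda>\<theta>. \<bar>log_mgf N (S 1) \<theta>\<bar> \<noteq> \<infinity>) (nhds 0)"
    and "prob_space.bounded_variation_process N S"
    and "\<not> prob_space.subordinator N S"
    and "prob_space.subordinator M S1" and "prob_space.subordinator M S2"
    and "\<not> prob_space.null_process M S1" and "\<not> prob_space.null_process M S2"
    and "prob_space.indep_processes M S1 S2"
    and "same_law N S M (\<lambda>t \<omega>. S1 t \<omega> - S2 t \<omega>)"
    and "admissible f1" and "admissible f2"
    and "prob_space.nonneg_process M L1" and "prob_space.nonneg_process M L2"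
    and "prob_space.indep_processes M L1 L2"
    and "prob_space.indep_process_pairs M L1 L2 S1 S2"
    and "log_mgf_limit M L1 f1" and "log_mgf_limit M L2 f2"
    and "essentially_smooth (Psi f1 f2 \<kappa>1 \<kappa>2)"
  shows "satisfies_LDP (completion M) (scaled_difference S1 L1 S2 L2) (\<lambda>t. t)
           (legendre_transform (Psi f1 f2 \<kappa>1 \<kappa>2)) \<and>
         good_rate_function (legendre_transform (Psi f1 f2 \<kappa>1 \<kappa>2))"
proof -
  interpret N: prob_space N by fact
  interpret M: prob_space M by fact
  interpret C: prob_space "completion M" by (rule M.prob_space_completion)
  note indep = \<open>M.indep_processes S1 S2\<close> \<open>M.indep_processes L1 L2\<close> \<open>M.indep_process_pairs L1 L2 S1 S2\<close>
  interpret P: subordinated_pair M S1 S2 L1 L2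
  proof
    show "(\<integral>\<^sup>+ \<omega>. (f (L1 s \<omega>) * f' (L2 s' \<omega>)) * (g (S1 t \<omega>) * g' (S2 t' \<omega>)) \<partial>M)
      = ((\<integral>\<^sup>+ \<omega>. f (L1 s \<omega>) \<partial>M) * (\<integral>\<^sup>+ \<omega>. f' (L2 s' \<omega>) \<partial>M))
        * ((\<integral>\<^sup>+ \<omega>. g (S1 t \<omega>) \<partial>M) * (\<integral>\<^sup>+ \<omega>. g' (S2 t' \<omega>) \<partial>M))"
      if "0 \<le> s" "0 \<le> s'" "0 \<le> t" "0 \<le> t'" "f \<in> borel_measurable borel" "f' \<in> borel_measurable borel"
        "g \<in> borel_measurable borel" "g' \<in> borel_measurable borel" for s s' t t' f f' g g'
      using indep(3,2,1) that by (rule M.indep_pairs_nn_integral)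
  qed fact+
  \<comment> \<open>The moments of \<open>S\<close> near \<open>0\<close> factor into those of \<open>S1\<close> and \<open>- S2\<close>. No factor vanishes, so each
    of them is finite, and \<open>0\<close> is an interior point of the domain of the limit.\<close>
  have mgf_S: "(\<integral>\<^sup>+ \<omega>. ennreal (exp (\<theta> * S 1 \<omega>)) \<partial>N) = P.mgf1 \<theta> * P.mgf2 (- \<theta>)" for \<theta>
  proof -
    have "(\<integral>\<^sup>+ \<omega>. ennreal (exp (\<theta> * S 1 \<omega>)) \<partial>N) = (\<integral>\<^sup>+ \<omega>. ennreal (exp (\<theta> * (S1 1 \<omega> - S2 1 \<omega>))) \<partial>M)"
      using \<open>N.levy_process S\<close> P.measurable_S
      by (intro same_law_nn_integral[OF \<open>same_law N S M _\<close>, where f = "\<lambda>x. ennreal (exp (\<theta> * x))"])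
        (auto simp: N.levy_process_def)
    also have "\<dots> = (\<integral>\<^sup>+ \<omega>. ennreal (exp (\<theta> * S1 1 \<omega>)) * ennreal (exp (- \<theta> * S2 1 \<omega>)) \<partial>M)"
      by (simp add: ennreal_mult[symmetric] exp_add[symmetric] right_diff_distrib)
    also have "\<dots> = P.mgf1 \<theta> * P.mgf2 (- \<theta>)"
      using M.indep_processes_nn_integral[OF indep(1), of 1 1 "\<lambda>x. ennreal (exp (\<theta> * x))" "\<lambda>x. ennreal (exp (- \<theta> * x))"]
      by simp
    finally show ?thesis .
  qed
  obtain \<epsilon> where \<epsilon>: "0 < \<epsilon>" "\<And>\<theta>. \<bar>\<theta>\<bar> < \<epsilon> \<Longrightarrow> \<bar>log_mgf N (S 1) \<theta>\<bar> \<noteq> \<infinity>"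
    using \<open>eventually _ (nhds 0)\<close> by (auto simp: eventually_nhds_metric)
  define \<delta> where "\<delta> = \<epsilon> / 2"
  have finite: "P.mgf1 \<theta> * P.mgf2 (- \<theta>) \<noteq> \<top>" if "\<bar>\<theta>\<bar> = \<delta>" for \<theta>
    using \<epsilon>(2)[of \<theta>] \<epsilon>(1) that unfolding mgf_S[symmetric] by (auto simp: \<delta>_def log_mgf_def ext_ln_def)
  have pos: "P.mgf1 \<theta> \<noteq> 0" "P.mgf2 \<theta> \<noteq> 0" for \<theta>
    using nn_integral_exp_pos[OF \<open>prob_space M\<close>] P.measurable_S by auto
  have \<delta>0: "0 < \<delta>" using \<epsilon>(1) by (simp add: \<delta>_def)
  have "P.mgf1 \<delta> \<noteq> \<top>"
    using finite[of \<delta>] pos(2)[of "- \<delta>"] \<delta>0 by (simp add: ennreal_mult_eq_top_iff)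
  moreover have "P.mgf2 \<delta> \<noteq> \<top>"
    using finite[of "- \<delta>"] pos(1)[of "- \<delta>"] \<delta>0 by (simp add: ennreal_mult_eq_top_iff)
  ultimately have \<delta>: "0 < \<delta>" "log_mgf M (S1 1) \<delta> < \<infinity>" "log_mgf M (S2 1) \<delta> < \<infinity>"
    using \<delta>0 unfolding log_mgf_def ext_ln_finite_iff by (simp_all add: less_top)
  interpret U: unimodal_cgf "Psi f1 f2 \<kappa>1 \<kappa>2"
    using P.unimodal_Psi[OF _ _ _ \<delta>] assms by (simp add: \<kappa>1_def \<kappa>2_def)
  interpret G: gartner_ellis "completion M" "Psi f1 f2 \<kappa>1 \<kappa>2" "scaled_difference S1 L1 S2 L2"
  proof
    fix t :: real assume "0 < t"
    then have "P.difference t \<in> borel_measurable (completion M)" by (intro P.measurable_difference) simp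
    then show "scaled_difference S1 L1 S2 L2 t \<in> borel_measurable (completion M)"
      unfolding scaled_difference_def[abs_def] P.difference_def[abs_def] by simp
  next
    fix \<theta> assume "Psi f1 f2 \<kappa>1 \<kappa>2 \<theta> < \<infinity>"
    then have lim: "((\<lambda>t. log_mgf M (P.difference t) \<theta> / ereal t) \<longlongrightarrow> Psi f1 f2 \<kappa>1 \<kappa>2 \<theta>) at_top"
      unfolding \<kappa>1_def \<kappa>2_def by (intro P.log_mgf_difference assms)
    have "\<forall>\<^sub>F t in at_top. log_mgf M (P.difference t) \<theta> / ereal t
        = log_mgf (completion M) (\<lambda>\<omega>. t * scaled_difference S1 L1 S2 L2 t \<omega>) \<theta> / ereal t"
      using eventually_gt_at_top[of 0]
      by eventually_elim (simp add: log_mgf_def nn_integral_completion scaled_difference_def P.difference_def)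
    with lim show "((\<lambda>t. log_mgf (completion M) (\<lambda>\<omega>. t * scaled_difference S1 L1 S2 L2 t \<omega>) \<theta> / ereal t)
        \<longlongrightarrow> Psi f1 f2 \<kappa>1 \<kappa>2 \<theta>) at_top"
      by (rule Lim_transform_eventually)
  qed
  show ?thesis using G.LDP U.good_rate_function_legendre by blast
qed

end
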